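(* Let $\Gamma$ be a finitely presented infinite amenable group and let $\Gamma=\Gamma_0>\Gamma_1>\Gamma_2>\cdots$ be an arbitrary chain of finite index subgroups of $\Gamma$. Then $\mathrm{RG}(\Gamma,(\Gamma_n))=0$.
   Context: For a finitely generated group $G$, $d(G)$ denotes the minimal number of generators of $G$. A chain in $\Gamma$ is a decreasing infinite sequence $\Gamma=\Gamma_0>\Gamma_1>\cdots$ of subgroups of finite index in $\Gamma$ (no normality and no trivial-intersection assumption). For $H\le\Gamma$ of finite index, $r(\Gamma,H)=(d(H)-1)/|\Gamma:H|$, and the rank gradient is $\mathrm{RG}(\Gamma,(\Gamma_n))=\lim_{n\to\infty} r(\Gamma,\Gamma_n)$ (this sequence is non-increasing, so the limit exists). *)

theory Defs
  imports "HOL-Algebra.Algebra"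
begin

definition word_eval :: "('a, 'b) monoid_scheme \<Rightarrow> ('a \<times> bool) list \<Rightarrow> 'a" where
  "word_eval G w = foldr (\<lambda>(x, b) y. (if b then x else inv\<^bsub>G\<^esub> x) \<otimes>\<^bsub>G\<^esub> y) w \<one>\<^bsub>G\<^esub>"

inductive pres_eq :: "('a \<times> bool) list set \<Rightarrow> ('a \<times> bool) list \<Rightarrow> ('a \<times> bool) list \<Rightarrow> bool"
  for R where
  refl: "pres_eq R w w"
| sym: "pres_eq R u v \<Longrightarrow> pres_eq R v u"
| trans: "pres_eq R u v \<Longrightarrow> pres_eq R v w \<Longrightarrow> pres_eq R u w"
| free: "pres_eq R (u @ v) (u @ [(x, b), (x, \<not> b)] @ v)"
| rel: "r \<in> R \<Longrightarrow> pres_eq R (u @ v) (u @ r @ v)"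

definition finitely_presented :: "('a, 'b) monoid_scheme \<Rightarrow> bool" where
  "finitely_presented G \<longleftrightarrow> (\<exists>S R. finite S \<and> S \<subseteq> carrier G \<and> generate G S = carrier G
      \<and> finite R \<and> (\<forall>r\<in>R. set r \<subseteq> S \<times> UNIV)
      \<and> (\<forall>w. set w \<subseteq> S \<times> UNIV \<longrightarrow> (word_eval G w = \<one>\<^bsub>G\<^esub> \<longleftrightarrow> pres_eq R w [])))"

definition amenable :: "('a, 'b) monoid_scheme \<Rightarrow> bool" where
  "amenable G \<longleftrightarrow> (\<exists>\<mu> :: 'a set \<Rightarrow> real.
      \<mu> (carrier G) = 1
    \<and> (\<forall>A \<subseteq> carrier G. \<mu> A \<ge> 0)
    \<and> (\<forall>A B. A \<subseteq> carrier G \<longrightarrow> B \<subseteq> carrier G \<longrightarrow> A \<inter> B = {} \<longrightarrow> \<mu> (A \<union> B) = \<mu> A + \<mu> B)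
    \<and> (\<forall>g\<in>carrier G. \<forall>A \<subseteq> carrier G. \<mu> (g <#\<^bsub>G\<^esub> A) = \<mu> A))"

definition min_gens :: "('a, 'b) monoid_scheme \<Rightarrow> nat" where
  "min_gens G = (LEAST n. \<exists>S. S \<subseteq> carrier G \<and> finite S \<and> card S = n \<and> generate G S = carrier G)"

definition group_index :: "('a, 'b) monoid_scheme \<Rightarrow> 'a set \<Rightarrow> nat" where
  "group_index G H = card (rcosets\<^bsub>G\<^esub> H)"

definition rg_ratio :: "('a, 'b) monoid_scheme \<Rightarrow> 'a set \<Rightarrow> real" where
  "rg_ratio G H = (real (min_gens (G\<lparr>carrier := H\<rparr>)) - 1) / real (group_index G H)"

definition is_chain :: "('a, 'b) monoid_scheme \<Rightarrow> (nat \<Rightarrow> 'a set) \<Rightarrow> bool" where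
  "is_chain G \<Gamma> \<longleftrightarrow> \<Gamma> 0 = carrier G
     \<and> (\<forall>n. subgroup (\<Gamma> n) G \<and> finite (rcosets\<^bsub>G\<^esub> (\<Gamma> n)) \<and> \<Gamma> (Suc n) \<subset> \<Gamma> n)"

end

theory Submission
  imports Defs "HOL-Library.Countable_Set"
begin

text \<open>Let \<open>H\<close> be a member of the chain, of large index \<open>n\<close>. Foelner sets cut the Schreier graph of \<open>H\<close> into
  pieces of bounded size with at most \<open>\<epsilon> n\<close> boundary vertices. Lifting the colouring by pieces to the
  Cayley graph gives components of colour classes, and, because the relators have bounded length,
  walls between them that stay apart from each other; simple connectivity of the Cayley complex makes
  components and walls the vertices of a tree on which \<open>H\<close> acts.

  The invariant mean of the group measures the two half-spaces of every tree edge. Orienting the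
  edge towards the larger one leaves at most one outgoing edge at each vertex, so any two vertices
  flow together, and \<open>H\<close> is generated by one vertex stabiliser and one more element. Edges that split
  the mean evenly are oriented after passing to a subgroup of index at most two. A vertex
  stabiliser is generated by a number of elements proportional to the number of cosets its vertex
  meets, which is bounded for a component and at most proportional to \<open>\<epsilon> n\<close> for a wall. Hence
  \<open>H\<close> has at most \<open>O(1) + O(\<epsilon> n)\<close> generators.\<close>

section \<open>Foelner sets\<close>

text \<open>Amenability enters in two guises: as Foelner sets, which make the boundary of the
  colouring sparse, and as the mean itself, which replaces the usual study of ends and free
  subgroups for an amenable group acting on a tree. As the chain may be neither normal nor of
  trivial intersection, one subgroup is treated at a time and the estimate has to be uniform: the
  size \<open>M\<close> of the pieces depends on the permitted density of the boundary but not on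
  \<open>H\<close>, so that a large index makes it negligible.

  Edges of the Cayley graph multiply on the right, so a colouring of the right cosets of
  \<open>H\<close> lifts to one that is invariant under left translation by \<open>H\<close>. The
  tree is never built as a graph. Simple connectivity shows that a wall separates, and the tree
  structure is then used through half-spaces: at a common wall the half-spaces of different
  components are disjoint, and at a common component the half-spaces of different walls cover the
  group. This is what leaves at most one outgoing edge. The nesting of arbitrary half-spaces enters
  when the mean is split evenly.\<close>

lemma hall_extend:
  fixes A :: "nat \<Rightarrow> 'a set"
  assumes fin: "\<And>i. finite (A i)"
    and hall: "\<And>J. J \<subseteq> {n..} \<Longrightarrow> finite J \<Longrightarrow> card J \<le> card ((\<Union>i\<in>J. A i) - U)"
  shows "\<exists>a\<in>A n - U. \<forall>J\<subseteq>{Suc n..}. finite J \<longrightarrow> card J \<le> card ((\<Union>i\<in>J. A i) - insert a U)"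
proof (rule ccontr)
  define f where "f J = (\<Union>i\<in>J. A i) - U" for J
  have f_fin: "finite (f J)" if "finite J" for J using that fin by (auto simp: f_def)
  have f_hall: "card J \<le> card (f J)" if "J \<subseteq> {n..}" "finite J" for J
    using hall[OF that] by (simp add: f_def)
  assume "\<not> ?thesis"
  then have "\<forall>a\<in>A n - U. \<exists>J\<subseteq>{Suc n..}. finite J \<and> card (f J - {a}) < card J"
    by (fastforce simp: f_def not_le set_diff_eq conj_ac)
  then obtain J where J: "\<And>a. a \<in> A n - U \<Longrightarrow> J a \<subseteq> {Suc n..} \<and> finite (J a) \<and> card (f (J a) - {a}) < card (J a)"
    by metis
  \<comment> \<open>Hall's condition holds for \<open>J a\<close> and fails once \<open>a\<close> is
    removed, so \<open>f (J a)\<close> contains \<open>a\<close> and has no element to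
    spare.\<close>
  have tight: "a \<in> f (J a) \<and> card (f (J a)) = card (J a)" if a: "a \<in> A n - U" for a
  proof -
    have "card (J a) \<le> card (f (J a))" using J[OF a] by (intro f_hall) force+
    moreover have "card (f (J a) - {a}) < card (J a)" using J[OF a] by blast
    ultimately show ?thesis using f_fin[of "J a"] J[OF a]
      by (cases "a \<in> f (J a)") (auto simp: card_Diff_singleton)
  qed
  \<comment> \<open>Tight index sets are closed under union: \<open>card (f J)\<close> is
    submodular, and the intersection of two index sets cannot fall below Hall's bound.\<close>
  have "\<exists>K\<subseteq>{Suc n..}. finite K \<and> E \<subseteq> f K \<and> card (f K) \<le> card K"
    if "finite E" "E \<subseteq> A n - U" for E
    using that
  proof (induction E)
    case empty
    then show ?case by (intro exI[of _ "{}"]) (auto simp: f_def)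
  next
    case (insert a E)
    then obtain K where K: "K \<subseteq> {Suc n..}" "finite K" "E \<subseteq> f K" "card (f K) \<le> card K" by auto
    have a: "a \<in> A n - U" using insert by auto
    note Ja = J[OF a] tight[OF a]
    have "f (K \<union> J a) = f K \<union> f (J a)" "f (K \<inter> J a) \<subseteq> f K \<inter> f (J a)" by (auto simp: f_def)
    moreover have "card (K \<inter> J a) \<le> card (f (K \<inter> J a))" using K by (intro f_hall) force+
    moreover have "card (f K \<union> f (J a)) + card (f K \<inter> f (J a)) = card (f K) + card (f (J a))"
      using f_fin K Ja by (metis card_Un_Int)
    moreover have "card (K \<union> J a) + card (K \<inter> J a) = card K + card (J a)"
      using K Ja by (metis card_Un_Int)
    moreover have "card (f (K \<inter> J a)) \<le> card (f K \<inter> f (J a))"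
      using calculation(2) f_fin K by (intro card_mono) auto
    ultimately have "card (f K \<union> f (J a)) \<le> card (K \<union> J a)" using K Ja by linarith
    then have "card (f (K \<union> J a)) \<le> card (K \<union> J a)" by (simp add: f_def UN_Un Un_Diff)
    then show ?case using K Ja by (intro exI[of _ "K \<union> J a"]) (auto simp: f_def)
  qed
  from this[of "A n - U"] fin obtain K where K: "K \<subseteq> {Suc n..}" "finite K" "A n - U \<subseteq> f K"
    "card (f K) \<le> card K" by auto
  \<comment> \<open>All of \<open>A n - U\<close> is already in \<open>f K\<close>, so
    \<open>insert n K\<close> has one index too many for Hall's condition.\<close>
  have "f (insert n K) = f K" using K by (auto simp: f_def)
  moreover have "card (insert n K) \<le> card (f (insert n K))" using K by (intro f_hall) force+
  moreover have "n \<notin> K" using K(1) by auto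
  then have "card (insert n K) = Suc (card K)" using K(2) by simp
  ultimately show False using K by simp
qed

text \<open>The invariant is Hall's condition for the indices still to come, with the used elements
  \<open>U\<close> removed. Some choice from \<open>A n\<close> always preserves it, so dependent
  choice produces distinct representatives without a limiting argument.\<close>

lemma hall_countable:
  fixes A :: "nat \<Rightarrow> 'a set"
  assumes fin: "\<And>i. finite (A i)"
    and hall: "\<And>J. finite J \<Longrightarrow> card J \<le> card (\<Union>i\<in>J. A i)"
  shows "\<exists>f. inj f \<and> (\<forall>i. f i \<in> A i)"
proof -
  define P where "P n U \<longleftrightarrow> (\<forall>J\<subseteq>{n..}. finite J \<longrightarrow> card J \<le> card ((\<Union>i\<in>J. A i) - U))" for n U
  have "\<exists>U. \<forall>n. P n (U n) \<and> (\<exists>a\<in>A n - U n. U (Suc n) = insert a (U n))"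
  proof (rule dependent_nat_choice)
    show "\<exists>x. P 0 x" using hall by (intro exI[of _ "{}"]) (auto simp: P_def)
  next
    fix U n assume "P n U"
    then show "\<exists>V. P (Suc n) V \<and> (\<exists>a\<in>A n - U. V = insert a U)"
      using hall_extend[where A=A and n=n and U=U] fin unfolding P_def by blast
  qed
  then obtain U where "\<And>n. \<exists>a\<in>A n - U n. U (Suc n) = insert a (U n)" by blast
  then obtain f where f: "\<And>n. f n \<in> A n - U n \<and> U (Suc n) = insert (f n) (U n)" by metis
  have mono: "U m \<subseteq> U n" if "m \<le> n" for m n
    using that by (rule lift_Suc_mono_le[rotated]) (use f in blast)
  have "f m \<noteq> f n" if "m < n" for m n
    using f[of m] f[of n] mono[of "Suc m" n] that by auto
  then have "inj f" by (intro injI) (metis nat_neq_iff)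
  then show ?thesis using f by blast
qed

section \<open>Finitely additive invariant means and paradoxical decompositions\<close>

locale mean_group = group G for G (structure) +
  fixes \<mu> :: "'a set \<Rightarrow> real"
  assumes mean_one: "\<mu> (carrier G) = 1"
    and mean_nonneg: "A \<subseteq> carrier G \<Longrightarrow> 0 \<le> \<mu> A"
    and mean_add: "A \<subseteq> carrier G \<Longrightarrow> B \<subseteq> carrier G \<Longrightarrow> A \<inter> B = {} \<Longrightarrow> \<mu> (A \<union> B) = \<mu> A + \<mu> B"
    and mean_inv: "g \<in> carrier G \<Longrightarrow> A \<subseteq> carrier G \<Longrightarrow> \<mu> ((\<otimes>) g ` A) = \<mu> A"
begin

lemma mean_empty: "\<mu> {} = 0"
  using mean_add[of "{}" "{}"] by simp

lemma mean_split: "A \<subseteq> carrier G \<Longrightarrow> \<mu> A = \<mu> (A \<inter> B) + \<mu> (A - B)"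
  using mean_add[of "A \<inter> B" "A - B"] by (simp add: Int_Diff_Un) blast

lemma mean_mono: "A \<subseteq> B \<Longrightarrow> B \<subseteq> carrier G \<Longrightarrow> \<mu> A \<le> \<mu> B"
  using mean_split[of B A] mean_nonneg[of "B - A"] by (auto simp: Int_absorb1)

lemma mean_sum:
  assumes "finite I" "\<And>i. i \<in> I \<Longrightarrow> A i \<subseteq> carrier G"
    "\<And>i j. i \<in> I \<Longrightarrow> j \<in> I \<Longrightarrow> i \<noteq> j \<Longrightarrow> A i \<inter> A j = {}"
  shows "\<mu> (\<Union>i\<in>I. A i) = (\<Sum>i\<in>I. \<mu> (A i))"
  using assms
proof (induction I)
  case empty
  then show ?case by (simp add: mean_empty)
next
  case (insert x I)
  have "\<mu> (A x \<union> (\<Union>i\<in>I. A i)) = \<mu> (A x) + \<mu> (\<Union>i\<in>I. A i)"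
    using insert by (intro mean_add) (auto, blast)
  also have "\<mu> (\<Union>i\<in>I. A i) = (\<Sum>i\<in>I. \<mu> (A i))"
    using insert by (intro insert.IH) auto
  finally show ?case using insert by simp
qed

text \<open>Such a \<open>\<theta>\<close> packs two copies of the group into itself by finitely
  many left translations. Sorted by the translating element and the copy, the pieces have total mean
  two; their translates are disjoint by injectivity and lie in a set of mean one.\<close>

lemma no_paradox:
  assumes "finite K" "K \<subseteq> carrier G"
    and \<theta>: "\<And>g b. g \<in> carrier G \<Longrightarrow> \<exists>k\<in>K. \<theta> (g, b :: bool) = k \<otimes> g"
    and inj: "inj_on \<theta> (carrier G \<times> UNIV)"
  shows False
proof -
  define A where "A = (\<lambda>(k, b). {g \<in> carrier G. \<theta> (g, b) = k \<otimes> g})"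
  have A_sub: "A i \<subseteq> carrier G" for i by (auto simp: A_def split: prod.splits)
  have cover: "(\<Union>k\<in>K. A (k, b)) = carrier G" for b using \<theta> by (auto simp: A_def)
  have "(\<Sum>k\<in>K. \<mu> (A (k, b))) = 1" for b
  proof -
    have "\<mu> (\<Union>k\<in>K. A (k, b)) = (\<Sum>k\<in>K. \<mu> (A (k, b)))"
      using assms by (intro mean_sum) (auto simp: A_def subset_iff)
    then show ?thesis using cover mean_one by simp
  qed
  then have two: "(\<Sum>i\<in>K \<times> UNIV. \<mu> (A i)) = 2"
    using assms(1) by (simp add: sum.cartesian_product' UNIV_bool sum.distrib)
  have img: "(\<otimes>) (fst i) ` A i \<subseteq> \<theta> ` (A i \<times> {snd i})" for i
    by (force simp: A_def l_coset_def split: prod.splits)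
  have "\<mu> (\<Union>i\<in>K \<times> UNIV. (\<otimes>) (fst i) ` A i) = (\<Sum>i\<in>K \<times> UNIV. \<mu> ((\<otimes>) (fst i) ` A i))"
  proof (rule mean_sum)
    show "finite (K \<times> (UNIV :: bool set))" using assms(1) by simp
    show "(\<otimes>) (fst i) ` A i \<subseteq> carrier G" if "i \<in> K \<times> UNIV" for i
      using that A_sub assms(2) by (auto simp: subset_iff)
    fix i j :: "'a \<times> bool" assume ij: "i \<in> K \<times> UNIV" "j \<in> K \<times> UNIV" "i \<noteq> j"
    have "A i \<times> {snd i} \<inter> A j \<times> {snd j} = {}"
      using ij assms(2) by (cases i; cases j) (auto simp: A_def subset_iff)
    then have "\<theta> ` (A i \<times> {snd i}) \<inter> \<theta> ` (A j \<times> {snd j}) = {}"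
      using inj_on_image_Int[OF inj, of "A i \<times> {snd i}" "A j \<times> {snd j}"] A_sub[of i] A_sub[of j]
      by (metis Sigma_mono image_is_empty subset_UNIV)
    then show "(\<otimes>) (fst i) ` A i \<inter> ((\<otimes>) (fst j) ` A j) = {}" using img[of i] img[of j] by blast
  qed
  also have "\<dots> = (\<Sum>i\<in>K \<times> UNIV. \<mu> (A i))"
    using A_sub assms(2) by (intro sum.cong HOL.refl mean_inv) auto
  finally have "\<mu> (\<Union>i\<in>K \<times> UNIV. (\<otimes>) (fst i) ` A i) = 2" using two by simp
  moreover have "\<mu> (\<Union>i\<in>K \<times> UNIV. (\<otimes>) (fst i) ` A i) \<le> \<mu> (carrier G)"
    using A_sub assms(2) by (intro mean_mono UN_least) (auto simp: subset_iff)
  ultimately show False using mean_one by simp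
qed

end

context mean_group begin

text \<open>If no Foelner set exists, every nonempty finite set grows by a factor of at least
  \<open>1 + \<delta>\<close> in one step. Iterated growth gives Hall's condition for the sets of
  translates of all group elements, each taken twice, and a matching is a paradoxical
  decomposition.\<close>

lemma foelner_left:
  assumes "countable (carrier G)" "infinite (carrier G)" "finite T" "T \<subseteq> carrier G" "\<delta> > 0"
  shows "\<exists>F. finite F \<and> F \<noteq> {} \<and> F \<subseteq> carrier G
    \<and> (\<forall>t\<in>T. real (card ((\<otimes>) t ` F - F)) \<le> \<delta> * real (card F))"
proof (rule ccontr)
  assume nF: "\<not> ?thesis"
  define grow where "grow E = E \<union> (\<Union>t\<in>T. (\<otimes>) t ` E)" for E
  have grow_fin: "finite ((grow ^^ n) E)" if "finite E" for n E
    using that assms(3) by (induction n) (auto simp: grow_def)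
  have grow_sub1: "grow E \<subseteq> carrier G" if "E \<subseteq> carrier G" for E
    using that assms(4) unfolding grow_def by blast
  have grow_sub: "(grow ^^ n) E \<subseteq> carrier G" if "E \<subseteq> carrier G" for n E
    using that by (induction n) (simp_all add: grow_sub1)
  have grow_ne: "(grow ^^ n) E \<noteq> {}" if "E \<noteq> {}" for n E
    using that by (induction n) (auto simp: grow_def)
  have grow1: "(1 + \<delta>) * real (card E) \<le> real (card (grow E))"
    if E: "finite E" "E \<noteq> {}" "E \<subseteq> carrier G" for E
  proof -
    obtain t where t: "t \<in> T" "\<delta> * real (card E) < real (card ((\<otimes>) t ` E - E))"
      using nF E by (metis not_le)
    have "card (E \<union> ((\<otimes>) t ` E - E)) \<le> card (grow E)"
      using t grow_fin[OF E(1), of 1] by (intro card_mono) (auto simp: grow_def)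
    moreover have "card (E \<union> ((\<otimes>) t ` E - E)) = card E + card ((\<otimes>) t ` E - E)"
      using E by (intro card_Un_disjoint) auto
    ultimately show ?thesis using t by (simp add: algebra_simps)
  qed
  have grown: "(1 + \<delta>) ^ n * real (card E) \<le> real (card ((grow ^^ n) E))"
    if E: "finite E" "E \<noteq> {}" "E \<subseteq> carrier G" for E n
  proof (induction n)
    case (Suc n)
    have "(1 + \<delta>) ^ Suc n * real (card E) = (1 + \<delta>) * ((1 + \<delta>) ^ n * real (card E))" by simp
    also have "\<dots> \<le> (1 + \<delta>) * real (card ((grow ^^ n) E))"
      using Suc assms(5) by (intro mult_left_mono) auto
    also have "\<dots> \<le> real (card (grow ((grow ^^ n) E)))"
      using E grow_fin grow_sub grow_ne by (intro grow1) auto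
    finally show ?case by simp
  qed simp
  \<comment> \<open>A factor of two is what Hall's condition asks for when every group element
    occurs in two copies.\<close>
  obtain n where n: "2 < (1 + \<delta>) ^ n" using assms(5) real_arch_pow[of "1 + \<delta>" 2] by auto
  define K where "K = (grow ^^ n) {\<one>}"
  have K: "finite K" "K \<subseteq> carrier G" using grow_fin grow_sub by (auto simp: K_def)
  \<comment> \<open>Growth multiplies on the left, hence commutes with right translation and is
    determined by what grows from the identity.\<close>
  have grow_eq: "(grow ^^ i) E = (\<Union>x\<in>E. (\<lambda>k. k \<otimes> x) ` (grow ^^ i) {\<one>})" if E: "E \<subseteq> carrier G" for i E
  proof (induction i)
    case 0
    have "\<one> \<otimes> x = x" if "x \<in> E" for x using that E by (intro l_one) auto
    then show ?case by auto
  next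
    case (Suc i)
    have "(\<otimes>) t ` (\<lambda>k. k \<otimes> x) ` (grow ^^ i) {\<one>} = (\<lambda>k. k \<otimes> x) ` (\<otimes>) t ` (grow ^^ i) {\<one>}"
      if "t \<in> T" "x \<in> E" for t x
      unfolding image_image using that assms(4) E grow_sub[of "{\<one>}" i]
      by (intro image_cong HOL.refl m_assoc[symmetric]) auto
    then have "grow ((\<lambda>k. k \<otimes> x) ` (grow ^^ i) {\<one>}) = (\<lambda>k. k \<otimes> x) ` grow ((grow ^^ i) {\<one>})"
      if "x \<in> E" for x
      unfolding grow_def image_Un image_UN using that by simp
    moreover have "grow (\<Union>x\<in>E. f x) = (\<Union>x\<in>E. grow (f x))" for f :: "'a \<Rightarrow> 'a set"
      unfolding grow_def by blast
    ultimately show ?case by (simp add: Suc)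
  qed
  define C where "C = carrier G \<times> (UNIV :: bool set)"
  have C: "countable C" "infinite C" using assms(1,2) by (auto simp: C_def finite_cartesian_product_iff)
  define e where "e = from_nat_into C"
  have e: "bij_betw e UNIV C" unfolding e_def by (rule bij_betw_from_nat_into[OF C])
  have e_in: "fst (e i) \<in> carrier G" for i using bij_betwE[OF e] by (auto simp: C_def mem_Times_iff)
  define A where "A i = (\<lambda>k. k \<otimes> fst (e i)) ` K" for i
  have "\<exists>f. inj f \<and> (\<forall>i. f i \<in> A i)"
  proof (rule hall_countable)
    show "finite (A i)" for i using K by (simp add: A_def)
    fix J :: "nat set" assume J: "finite J"
    define E where "E = (fst \<circ> e) ` J"
    have E: "finite E" "E \<subseteq> carrier G" using J e_in by (auto simp: E_def)
    have UA: "(\<Union>i\<in>J. A i) = (grow ^^ n) E" using grow_eq[OF E(2), of n] by (auto simp: A_def K_def E_def)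
    have "card J = card (e ` J)" using e by (metis bij_betw_def card_image inj_on_subset subset_UNIV)
    also have "\<dots> \<le> card (E \<times> (UNIV :: bool set))"
      using E by (intro card_mono image_subsetI) (simp_all add: E_def mem_Times_iff)
    also have "\<dots> = 2 * card E" by (simp add: card_cartesian_product UNIV_bool)
    finally have "real (card J) \<le> 2 * real (card E)" by linarith
    also have "\<dots> \<le> (1 + \<delta>) ^ n * real (card E)" using n by (intro mult_right_mono) auto
    also have "\<dots> \<le> real (card ((grow ^^ n) E))" using grown[of E n] E by (cases "E = {}") auto
    finally show "card J \<le> card (\<Union>i\<in>J. A i)" using UA by simp
  qed
  then obtain f where f: "inj f" "\<And>i. f i \<in> A i" by blast
  define \<theta> where "\<theta> p = f (to_nat_on C p)" for p
  show False
  proof (rule no_paradox[OF K])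
    fix g and b :: bool assume "g \<in> carrier G"
    then have "e (to_nat_on C (g, b)) = (g, b)" using C by (simp add: e_def C_def)
    then show "\<exists>k\<in>K. \<theta> (g, b) = k \<otimes> g" using f(2)[of "to_nat_on C (g, b)"] by (auto simp: \<theta>_def A_def)
  next
    show "inj_on \<theta> (carrier G \<times> UNIV)"
      using comp_inj_on[OF inj_on_to_nat_on[OF C(1)], of f] f(1)
      by (simp add: \<theta>_def[abs_def] C_def comp_def inj_on_subset)
  qed
qed

text \<open>The Schreier graph sees right translates, its edges leading from \<open>u\<close> to
  \<open>u #> t\<close>. Inverting a Foelner set for the inverse elements exchanges the two
  sides.\<close>

lemma foelner_right:
  assumes "countable (carrier G)" "infinite (carrier G)" "finite T" "T \<subseteq> carrier G" "\<delta> > 0"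
  shows "\<exists>F. finite F \<and> F \<noteq> {} \<and> F \<subseteq> carrier G
    \<and> (\<forall>t\<in>T. real (card ((\<lambda>x. x \<otimes> t) ` F - F)) \<le> \<delta> * real (card F))"
proof -
  have "finite (m_inv G ` T)" "m_inv G ` T \<subseteq> carrier G" using assms by auto
  from foelner_left[OF assms(1,2) this assms(5)]
  obtain F where F: "finite F" "F \<noteq> {}" "F \<subseteq> carrier G"
    "\<And>t. t \<in> T \<Longrightarrow> real (card ((\<otimes>) (inv t) ` F - F)) \<le> \<delta> * real (card F)" by auto
  have inj: "inj_on (m_inv G) A" if "A \<subseteq> carrier G" for A
    using that by (intro inj_onI) (metis inv_inv subsetD)
  have "card ((\<lambda>x. x \<otimes> t) ` m_inv G ` F - m_inv G ` F) = card ((\<otimes>) (inv t) ` F - F)" if t: "t \<in> T" for t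
  proof -
    have t': "t \<in> carrier G" using t assms by auto
    have "(\<lambda>x. x \<otimes> t) ` m_inv G ` F = m_inv G ` (\<otimes>) (inv t) ` F"
      unfolding image_image using F(3) t' by (intro image_cong) (auto simp: inv_mult_group)
    then have "(\<lambda>x. x \<otimes> t) ` m_inv G ` F - m_inv G ` F = m_inv G ` ((\<otimes>) (inv t) ` F - F)"
      using F(3) t' by (subst inj_on_image_set_diff[OF inj[of "carrier G"]]) auto
    moreover have "(\<otimes>) (inv t) ` F - F \<subseteq> carrier G" using F(3) t' by auto
    ultimately show ?thesis by (simp add: card_image inj)
  qed
  then show ?thesis using F by (intro exI[of _ "m_inv G ` F"]) (auto simp: card_image inj)
qed

end

section \<open>Cutting a finite graph along level sets\<close>

lemma sum_of_bool_le:
  assumes "p \<le> (m :: nat)" shows "(\<Sum>l\<in>{1..m}. of_bool (l \<le> p)) = real p"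
proof -
  have "{1..m} \<inter> {l. l \<le> p} = {1..p}" using assms by auto
  then show ?thesis by (simp add: of_bool_def sum.If_cases)
qed

lemma sum_of_bool_le_neq:
  assumes "p \<le> (m :: nat)" "q \<le> m"
  shows "(\<Sum>l\<in>{1..m}. of_bool ((l \<le> p) \<noteq> (l \<le> q))) = \<bar>real p - real q\<bar>"
proof -
  have "{1..m} \<inter> {l. (l \<le> p) \<noteq> (l \<le> q)} = {Suc (min p q)..max p q}" using assms by auto
  then have "(\<Sum>l\<in>{1..m}. of_bool ((l \<le> p) \<noteq> (l \<le> q))) = real (card {Suc (min p q)..max p q})"
    unfolding of_bool_def by (subst sum.If_cases) auto
  then show ?thesis by (auto simp: min_def max_def)
qed

text \<open>Read \<open>f x u\<close> as the multiplicity with which tile \<open>x\<close> covers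
  vertex \<open>u\<close>. Over all tiles and levels, the sizes of the level sets add up to
  \<open>m\<close> times \<open>card Z\<close> and their edge boundaries to at most
  \<open>\<delta> * card T\<close> times as much; so some nonempty level set is no worse than the
  average.\<close>

lemma level_set_small_boundary:
  fixes f :: "'i \<Rightarrow> 'v \<Rightarrow> nat" and a :: "'t \<Rightarrow> 'v \<Rightarrow> 'v"
  assumes fin: "finite Z" "finite I" "finite T" and "Z \<noteq> {}" "m > 0" "\<delta> \<ge> 0"
    and total: "\<And>u. u \<in> Z \<Longrightarrow> (\<Sum>x\<in>I. f x u) = m"
    and var: "\<And>u t. u \<in> Z \<Longrightarrow> t \<in> T \<Longrightarrow> (\<Sum>x\<in>I. \<bar>real (f x u) - real (f x (a t u))\<bar>) \<le> \<delta> * real m"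
  shows "\<exists>x\<in>I. \<exists>l>0. {u\<in>Z. l \<le> f x u} \<noteq> {} \<and>
    real (card {(u, t) \<in> Z \<times> T. a t u \<in> Z \<and> (l \<le> f x u) \<noteq> (l \<le> f x (a t u))})
      \<le> \<delta> * real (card T) * real (card {u\<in>Z. l \<le> f x u})"
proof (rule ccontr)
  define Q where "Q = {(u, t) \<in> Z \<times> T. a t u \<in> Z}"
  have Q: "finite Q" "Q \<subseteq> Z \<times> T" using fin by (auto simp: Q_def intro: finite_subset[of _ "Z \<times> T"])
  define L where "L = I \<times> {1..m}"
  define wt where "wt = (\<lambda>(x, l). real (card {u\<in>Z. l \<le> f x u}))"
  define ct where "ct = (\<lambda>(x, l). real (card {(u, t) \<in> Z \<times> T. a t u \<in> Z \<and> (l \<le> f x u) \<noteq> (l \<le> f x (a t u))}))"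
  assume neg: "\<not> ?thesis"
  have f_le: "f x u \<le> m" if "x \<in> I" "u \<in> Z" for x u
    using total[OF that(2)] that fin member_le_sum[of x I "\<lambda>x. f x u"] by auto
  have L: "finite L" using fin by (simp add: L_def)
  have wt: "wt p = (\<Sum>u\<in>Z. of_bool (snd p \<le> f (fst p) u))" for p
    using fin by (simp add: wt_def of_bool_def sum.If_cases case_prod_beta Int_def)
  have ct: "ct p = (\<Sum>(u, t)\<in>Q. of_bool ((snd p \<le> f (fst p) u) \<noteq> (snd p \<le> f (fst p) (a t u))))" for p
  proof -
    have "{(u, t) \<in> Z \<times> T. a t u \<in> Z \<and> (snd p \<le> f (fst p) u) \<noteq> (snd p \<le> f (fst p) (a t u))} =
      Q \<inter> {z. (snd p \<le> f (fst p) (fst z)) \<noteq> (snd p \<le> f (fst p) (a (snd z) (fst z)))}"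
      by (auto simp: Q_def)
    then show ?thesis using Q by (simp add: ct_def of_bool_def sum.If_cases case_prod_beta)
  qed
  have "(\<Sum>p\<in>L. wt p) = (\<Sum>u\<in>Z. \<Sum>p\<in>L. of_bool (snd p \<le> f (fst p) u))"
    unfolding wt by (rule sum.swap)
  also have "\<dots> = (\<Sum>u\<in>Z. \<Sum>x\<in>I. \<Sum>l\<in>{1..m}. of_bool (l \<le> f x u))"
    by (simp only: L_def sum.cartesian_product' fst_conv snd_conv)
  also have "\<dots> = (\<Sum>u\<in>Z. \<Sum>x\<in>I. real (f x u))"
    using f_le by (intro sum.cong HOL.refl sum_of_bool_le) auto
  also have "\<dots> = (\<Sum>u\<in>Z. real m)" using total[THEN arg_cong[where f=real], unfolded of_nat_sum] by (rule sum.cong[OF HOL.refl])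
  finally have sum_wt: "(\<Sum>p\<in>L. wt p) = real m * real (card Z)" by simp
  have "(\<Sum>p\<in>L. ct p) = (\<Sum>z\<in>Q. \<Sum>p\<in>L. of_bool ((snd p \<le> f (fst p) (fst z)) \<noteq> (snd p \<le> f (fst p) (a (snd z) (fst z)))))"
    unfolding ct case_prod_beta by (rule sum.swap)
  also have "\<dots> = (\<Sum>z\<in>Q. \<Sum>x\<in>I. \<Sum>l\<in>{1..m}. of_bool ((l \<le> f x (fst z)) \<noteq> (l \<le> f x (a (snd z) (fst z)))))"
    by (simp only: L_def sum.cartesian_product' fst_conv snd_conv)
  also have "\<dots> = (\<Sum>z\<in>Q. \<Sum>x\<in>I. \<bar>real (f x (fst z)) - real (f x (a (snd z) (fst z)))\<bar>)"
    using f_le by (intro sum.cong HOL.refl sum_of_bool_le_neq) (auto simp: Q_def)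
  also have "\<dots> \<le> (\<Sum>z\<in>Q. \<delta> * real m)"
    using Q by (intro sum_mono var) auto
  also have "\<dots> = real (card Q) * (\<delta> * real m)" by simp
  also have "\<dots> \<le> real (card Z * card T) * (\<delta> * real m)"
  proof (rule mult_right_mono)
    show "real (card Q) \<le> real (card Z * card T)"
      using card_mono[OF _ Q(2)] fin unfolding of_nat_le_iff by (simp add: card_cartesian_product)
  qed (use assms(6) in simp)
  finally have "(\<Sum>p\<in>L. ct p) \<le> (\<Sum>p\<in>L. \<delta> * real (card T) * wt p)"
    unfolding sum_distrib_left[symmetric] sum_wt by (simp add: mult_ac)
  \<comment> \<open>Empty level sets satisfy the weak inequality trivially; as the total weight is
    positive, some nonempty one makes it strict.\<close>
  moreover have "(\<Sum>p\<in>L. \<delta> * real (card T) * wt p) < (\<Sum>p\<in>L. ct p)"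
  proof (rule sum_strict_mono_ex1[OF L])
    have gt: "\<delta> * real (card T) * wt p < ct p" if pL: "p \<in> L" "wt p \<noteq> 0" for p
    proof -
      obtain x l where p: "p = (x, l)" "x \<in> I" "l > 0" using pL by (auto simp: L_def)
      have "{u\<in>Z. l \<le> f x u} \<noteq> {}" using pL(2) by (auto simp: p wt_def simp del: Collect_empty_eq)
      with neg p show ?thesis unfolding wt_def ct_def p(1) case_prod_conv by (meson not_le)
    qed
    have "0 \<le> ct p" for p by (simp add: ct_def case_prod_beta)
    then show "\<forall>p\<in>L. \<delta> * real (card T) * wt p \<le> ct p" using gt
      by (metis less_imp_le mult_zero_right)
    have "0 < (\<Sum>p\<in>L. wt p)" using sum_wt assms(4,5) fin by (simp add: card_gt_0_iff)
    then obtain p where "p \<in> L" "wt p \<noteq> 0" by (metis less_irrefl sum.neutral)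
    then show "\<exists>p\<in>L. \<delta> * real (card T) * wt p < ct p" using gt by blast
  qed
  ultimately show False by simp
qed

text \<open>Level sets are cut off one after another. Only edges inside the remaining set count, and
  the hypotheses on \<open>f\<close> survive its shrinking, so each cut \<open>W\<close> is charged
  in proportion to \<open>card W\<close> and the charges add up. A level above zero lies in the
  support of one tile, whence the bound \<open>M\<close>. The colour of a vertex is its piece
  itself.\<close>

lemma greedy_partition:
  fixes f :: "'i \<Rightarrow> 'v \<Rightarrow> nat" and a :: "'t \<Rightarrow> 'v \<Rightarrow> 'v"
  assumes fin: "finite V" "finite I" "finite T" and "m > 0" "\<delta> \<ge> 0"
    and total: "\<And>u. u \<in> V \<Longrightarrow> (\<Sum>x\<in>I. f x u) = m"
    and var: "\<And>u t. u \<in> V \<Longrightarrow> t \<in> T \<Longrightarrow> (\<Sum>x\<in>I. \<bar>real (f x u) - real (f x (a t u))\<bar>) \<le> \<delta> * real m"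
    and supp: "\<And>x. x \<in> I \<Longrightarrow> card {u\<in>V. 0 < f x u} \<le> M"
    and "Z \<subseteq> V"
  shows "\<exists>\<kappa>. (\<forall>u\<in>Z. u \<in> \<kappa> u \<and> \<kappa> u \<subseteq> Z \<and> card (\<kappa> u) \<le> M) \<and>
    real (card {(u, t) \<in> Z \<times> T. a t u \<in> Z \<and> \<kappa> u \<noteq> \<kappa> (a t u)}) \<le> \<delta> * real (card T) * real (card Z)"
proof -
  have "finite Z" using assms(9) fin(1) by (rule finite_subset)
  then show ?thesis using assms(9)
  proof (induction Z rule: finite_psubset_induct)
    case (psubset Z)
    show ?case
    proof (cases "Z = {}")
      case False
      have "\<And>u. u \<in> Z \<Longrightarrow> u \<in> V" using psubset(3) by blast
      from level_set_small_boundary[where f=f and a=a, OF psubset(1) fin(2,3) False assms(4,5) total[OF this] var[OF this]]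
      obtain x l where xl: "x \<in> I" "l > 0" "{u\<in>Z. l \<le> f x u} \<noteq> {}"
        "real (card {(u, t) \<in> Z \<times> T. a t u \<in> Z \<and> (l \<le> f x u) \<noteq> (l \<le> f x (a t u))})
          \<le> \<delta> * real (card T) * real (card {u\<in>Z. l \<le> f x u})" by blast
      define W where "W = {u\<in>Z. l \<le> f x u}"
      have W: "W \<subseteq> Z" "W \<noteq> {}" "finite W" using xl psubset(1) by (auto simp: W_def)
      have "card W \<le> card {u\<in>V. 0 < f x u}"
        using xl psubset(3) fin by (intro card_mono) (auto simp: W_def)
      then have W_le: "card W \<le> M" using supp[OF xl(1)] by linarith
      have "Z - W \<subset> Z" "Z - W \<subseteq> V" using W psubset(3) by auto
      from psubset.IH[OF this] obtain \<kappa> where \<kappa>: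
        "\<And>u. u \<in> Z - W \<Longrightarrow> u \<in> \<kappa> u \<and> \<kappa> u \<subseteq> Z - W \<and> card (\<kappa> u) \<le> M"
        "real (card {(u, t) \<in> (Z - W) \<times> T. a t u \<in> Z - W \<and> \<kappa> u \<noteq> \<kappa> (a t u)})
          \<le> \<delta> * real (card T) * real (card (Z - W))" by auto
      define \<kappa>' where "\<kappa>' u = (if u \<in> W then W else \<kappa> u)" for u
      have "{(u, t) \<in> Z \<times> T. a t u \<in> Z \<and> \<kappa>' u \<noteq> \<kappa>' (a t u)} \<subseteq>
        {(u, t) \<in> Z \<times> T. a t u \<in> Z \<and> (l \<le> f x u) \<noteq> (l \<le> f x (a t u))} \<union>
        {(u, t) \<in> (Z - W) \<times> T. a t u \<in> Z - W \<and> \<kappa> u \<noteq> \<kappa> (a t u)}" (is "?A \<subseteq> ?B \<union> ?C")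
      proof
        fix p assume "p \<in> ?A"
        then obtain u t where p: "p = (u, t)" "u \<in> Z" "t \<in> T" "a t u \<in> Z" "\<kappa>' u \<noteq> \<kappa>' (a t u)" by blast
        show "p \<in> ?B \<union> ?C"
        proof (cases "(u \<in> W) = (a t u \<in> W)")
          case True
          then have "u \<notin> W" "a t u \<notin> W" using p(5) by (auto simp: \<kappa>'_def)
          then show ?thesis using p by (simp add: \<kappa>'_def)
        next
          case False
          then show ?thesis using p by (simp add: W_def)
        qed
      qed
      moreover have "finite ?B" by (rule finite_subset[of _ "Z \<times> T"]) (use psubset(1) fin in auto)
      moreover have "finite ?C" by (rule finite_subset[of _ "Z \<times> T"]) (use psubset(1) fin in auto)
      ultimately have "card ?A \<le> card (?B \<union> ?C)" by (intro card_mono finite_UnI)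
      also have "\<dots> \<le> card ?B + card ?C" by (rule card_Un_le)
      finally have "card ?A \<le> card ?B + card ?C" .
      then have "real (card ?A) \<le> \<delta> * real (card T) * real (card W) + \<delta> * real (card T) * real (card (Z - W))"
        using xl(4) \<kappa>(2) unfolding W_def[symmetric] by linarith
      also have "\<dots> = \<delta> * real (card T) * real (card W + card (Z - W))" by (simp add: algebra_simps)
      also have "card W + card (Z - W) = card Z"
        using W psubset(1) by (simp add: card_Diff_subset card_mono)
      finally have bd: "real (card ?A) \<le> \<delta> * real (card T) * real (card Z)" .
      have "u \<in> \<kappa>' u \<and> \<kappa>' u \<subseteq> Z \<and> card (\<kappa>' u) \<le> M" if "u \<in> Z" for u
        using that \<kappa>(1)[of u] W W_le by (auto simp: \<kappa>'_def)
      with bd show ?thesis by blast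
    next
      case True
      then show ?thesis by simp
    qed
  qed
qed

section \<open>Partitioning the Schreier graph\<close>

context group begin

lemma rcosets_r_coset:
  assumes "subgroup H G" "u \<in> rcosets H" "t \<in> carrier G"
  shows "u #> t \<in> rcosets H"
proof -
  obtain g where g: "g \<in> carrier G" "u = H #> g" using assms(2) by (auto simp: RCOSETS_def)
  then have "u #> t = H #> (g \<otimes> t)" using assms by (simp add: coset_mult_assoc subgroup.subset)
  then show ?thesis using g assms(3) by (auto simp: RCOSETS_def)
qed

lemma rcosets_r_coset_eq_iff:
  assumes "subgroup H G" "u \<in> rcosets H" "v \<in> rcosets H" "t \<in> carrier G"
  shows "v #> t = u \<longleftrightarrow> v = u #> inv t"
proof -
  have "u \<subseteq> carrier G" "v \<subseteq> carrier G"
    using assms by (auto dest: subgroup.rcosets_carrier[OF _ is_group])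
  then show ?thesis using assms(4) by (auto simp: coset_mult_assoc)
qed

text \<open>Each \<open>y\<close> carries exactly one coset to \<open>u\<close>, namely
  \<open>u #> inv y\<close>. Thus the tiles based at all cosets cover every coset equally often,
  even if \<open>F\<close> does not embed into the coset space.\<close>

lemma sum_card_coset_translates:
  assumes "subgroup H G" "finite (rcosets H)" "finite F" "F \<subseteq> carrier G" "u \<in> rcosets H"
  shows "(\<Sum>x\<in>rcosets H. card {y\<in>F. x #> y = u}) = card F"
proof -
  have "(\<Sum>x\<in>rcosets H. card {y\<in>F. x #> y = u}) = (\<Sum>x\<in>rcosets H. \<Sum>y\<in>F. if x #> y = u then 1 else 0)"
    using assms(3) by (simp add: sum.If_cases Int_def)
  also have "\<dots> = (\<Sum>y\<in>F. \<Sum>x\<in>rcosets H. if x #> y = u then 1 else 0)" by (rule sum.swap)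
  also have "\<dots> = (\<Sum>y\<in>F. 1)"
  proof (rule sum.cong[OF HOL.refl])
    fix y assume y: "y \<in> F"
    then have yc: "y \<in> carrier G" using assms(4) by blast
    have "rcosets H \<inter> {x. x #> y = u} = {u #> inv y}"
      using rcosets_r_coset_eq_iff[OF assms(1,5) _ yc] rcosets_r_coset[OF assms(1,5) inv_closed[OF yc]]
      by blast
    then show "(\<Sum>x\<in>rcosets H. if x #> y = u then 1 else 0) = 1"
      using assms(2) by (simp add: sum.If_cases)
  qed
  finally show ?thesis by simp
qed

text \<open>Moving from \<open>u\<close> to \<open>u #> t\<close> changes the counts as replacing
  \<open>F\<close> by its right translate under \<open>inv t\<close> does. The symmetric difference
  pays for the change, and its two halves have equal size; hence the factor two.\<close>

lemma sum_card_coset_translates_diff: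
  assumes H: "subgroup H G" "finite (rcosets H)" and F: "finite F" "F \<subseteq> carrier G"
    and u: "u \<in> rcosets H" and t: "t \<in> carrier G"
    and small: "real (card ((\<lambda>x. x \<otimes> inv t) ` F - F)) \<le> \<delta> * real (card F)"
  shows "(\<Sum>x\<in>rcosets H. \<bar>real (card {y\<in>F. x #> y = u}) - real (card {y\<in>F. x #> y = u #> t})\<bar>)
    \<le> 2 * \<delta> * real (card F)"
proof -
  define E where "E = (\<lambda>x. x \<otimes> inv t) ` F"
  have E: "finite E" "E \<subseteq> carrier G" using F t by (auto simp: E_def)
  have inj: "inj_on (\<lambda>x. x \<otimes> inv t) A" if "A \<subseteq> carrier G" for A
    using that t by (auto simp: inj_on_def subset_iff)
  have shift: "card {y\<in>F. x #> y = u #> t} = card {y\<in>E. x #> y = u}" if x: "x \<in> rcosets H" for x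
  proof -
    have xc: "x \<subseteq> carrier G" using x H by (auto dest: subgroup.rcosets_carrier[OF _ is_group])
    have "x #> y = u #> t \<longleftrightarrow> x #> (y \<otimes> inv t) = u" if "y \<in> F" for y
    proof -
      have y: "y \<in> carrier G" using that F by auto
      have "x #> (y \<otimes> inv t) = (x #> y) #> inv t" using xc y t by (simp add: coset_mult_assoc)
      then show ?thesis
        using rcosets_r_coset_eq_iff[OF H(1) u rcosets_r_coset[OF H(1) x y], of "inv t"] t by simp
    qed
    then have "{y\<in>E. x #> y = u} = (\<lambda>x. x \<otimes> inv t) ` {y\<in>F. x #> y = u #> t}"
      by (auto simp: E_def)
    then show ?thesis using F by (subst card_image[OF inj, symmetric]) auto
  qed
  have bound: "\<bar>real (card {y\<in>F. x #> y = u}) - real (card {y\<in>E. x #> y = u})\<bar>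
    \<le> real (card {y\<in>(F - E) \<union> (E - F). x #> y = u})" for x
  proof -
    have le: "card {y\<in>A. x #> y = u} \<le> card {y\<in>A'. x #> y = u} + card {y\<in>(F - E) \<union> (E - F). x #> y = u}"
      if "A = F \<and> A' = E \<or> A = E \<and> A' = F" for A A'
    proof -
      have "card {y\<in>A. x #> y = u} \<le> card ({y\<in>A'. x #> y = u} \<union> {y\<in>(F - E) \<union> (E - F). x #> y = u})"
        using that E F by (intro card_mono) auto
      then show ?thesis using card_Un_le le_trans by blast
    qed
    have "F = F \<and> E = E \<or> F = E \<and> E = F" "E = F \<and> F = E \<or> E = E \<and> F = F" by auto
    from this[THEN le] show ?thesis by linarith
  qed
  have "card E = card F" unfolding E_def using F by (intro card_image inj)
  then have "card (F - E) = card (E - F)"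
    using E F by (metis card_Diff_subset_Int finite_Int inf_commute)
  then have "card ((F - E) \<union> (E - F)) = 2 * card (E - F)"
    using E F by (subst card_Un_disjoint) auto
  then have D: "real (card ((F - E) \<union> (E - F))) \<le> 2 * \<delta> * real (card F)"
    using small unfolding E_def by simp
  have "(\<Sum>x\<in>rcosets H. \<bar>real (card {y\<in>F. x #> y = u}) - real (card {y\<in>F. x #> y = u #> t})\<bar>)
    \<le> (\<Sum>x\<in>rcosets H. real (card {y\<in>(F - E) \<union> (E - F). x #> y = u}))"
    by (rule sum_mono) (use bound shift in simp)
  also have "\<dots> = real (card ((F - E) \<union> (E - F)))"
  proof -
    have "(F - E) \<union> (E - F) \<subseteq> carrier G" using E F by auto
    moreover have "finite ((F - E) \<union> (E - F))" using E F by simp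
    ultimately have "(\<Sum>x\<in>rcosets H. card {y\<in>(F - E) \<union> (E - F). x #> y = u}) = card ((F - E) \<union> (E - F))"
      using sum_card_coset_translates[OF H _ _ u] by blast
    from arg_cong[OF this, of real, unfolded of_nat_sum] show ?thesis .
  qed
  finally show ?thesis using D by linarith
qed

end

text \<open>The tile at a coset \<open>x\<close> is the image of \<open>F\<close> under
  \<open>y\<close> to \<open>x #> y\<close>, with multiplicity. Since \<open>F\<close> is chosen
  before \<open>H\<close>, the bound \<open>M = card F\<close> is uniform over all subgroups of
  finite index.\<close>

lemma (in mean_group) coset_partition:
  assumes "countable (carrier G)" "infinite (carrier G)" "finite T" "T \<subseteq> carrier G" "\<epsilon> > 0"
  shows "\<exists>M. \<forall>H. subgroup H G \<and> finite (rcosets H) \<longrightarrow>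
    (\<exists>\<kappa> :: 'a set \<Rightarrow> 'a set set. (\<forall>u\<in>rcosets H. card {v\<in>rcosets H. \<kappa> v = \<kappa> u} \<le> M) \<and>
      real (card {u\<in>rcosets H. \<exists>t\<in>T. \<kappa> (u #> t) \<noteq> \<kappa> u}) \<le> \<epsilon> * real (card (rcosets H)))"
proof -
  \<comment> \<open>The 2 comes from the symmetric difference, \<open>card T\<close> from the edges
    at each vertex; the summand 1 keeps the denominator positive for empty \<open>T\<close>.\<close>
  define \<delta> where "\<delta> = \<epsilon> / (2 * (1 + real (card T)))"
  have \<delta>: "\<delta> > 0" using assms(5) by (simp add: \<delta>_def)
  have "finite (m_inv G ` T)" "m_inv G ` T \<subseteq> carrier G" using assms by auto
  from foelner_right[OF assms(1,2) this \<delta>]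
  obtain F where F: "finite F" "F \<noteq> {}" "F \<subseteq> carrier G"
    "\<And>t. t \<in> T \<Longrightarrow> real (card ((\<lambda>x. x \<otimes> inv t) ` F - F)) \<le> \<delta> * real (card F)" by auto
  show ?thesis
  proof (intro exI[of _ "card F"] allI impI)
    fix H assume "subgroup H G \<and> finite (rcosets H)"
    then have H: "subgroup H G" "finite (rcosets H)" by auto
    have tot: "(\<Sum>x\<in>rcosets H. card {y\<in>F. x #> y = u}) = card F" if "u \<in> rcosets H" for u
      using sum_card_coset_translates[OF H F(1,3) that] .
    have var: "(\<Sum>x\<in>rcosets H. \<bar>real (card {y\<in>F. x #> y = u}) - real (card {y\<in>F. x #> y = u #> t})\<bar>)
      \<le> 2 * \<delta> * real (card F)" if "u \<in> rcosets H" "t \<in> T" for u t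
      using assms(4) that by (intro sum_card_coset_translates_diff[OF H F(1,3) _ _ F(4)]) auto
    have supp: "card {u\<in>rcosets H. 0 < card {y\<in>F. x #> y = u}} \<le> card F" for x
    proof -
      have "{u\<in>rcosets H. 0 < card {y\<in>F. x #> y = u}} \<subseteq> (\<lambda>y. x #> y) ` F"
        using F(1) by (auto simp: card_gt_0_iff)
      then show ?thesis using F(1) by (meson card_image_le card_mono finite_imageI le_trans)
    qed
    have pos: "0 < card F" "0 \<le> 2 * \<delta>" using F \<delta> by (auto simp: card_gt_0_iff)
    from greedy_partition[where f="\<lambda>x u. card {y\<in>F. x #> y = u}" and a="\<lambda>t u. u #> t",
        OF H(2,2) assms(3) pos tot var supp subset_refl]
    obtain \<kappa> where \<kappa>: "\<And>u. u \<in> rcosets H \<Longrightarrow> u \<in> \<kappa> u \<and> \<kappa> u \<subseteq> rcosets H \<and> card (\<kappa> u) \<le> card F"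
      "real (card {(u, t) \<in> (rcosets H) \<times> T. u #> t \<in> rcosets H \<and> \<kappa> u \<noteq> \<kappa> (u #> t)})
        \<le> 2 * \<delta> * real (card T) * real (card (rcosets H))" by blast
    have "card {v\<in>rcosets H. \<kappa> v = \<kappa> u} \<le> card F" if u: "u \<in> rcosets H" for u
    proof -
      have "{v\<in>rcosets H. \<kappa> v = \<kappa> u} \<subseteq> \<kappa> u" using \<kappa>(1) by blast
      moreover have "finite (\<kappa> u)" using \<kappa>(1)[OF u] H(2) finite_subset by blast
      ultimately show ?thesis using \<kappa>(1)[OF u] card_mono le_trans by blast
    qed
    moreover have "real (card {u\<in>rcosets H. \<exists>t\<in>T. \<kappa> (u #> t) \<noteq> \<kappa> u}) \<le> \<epsilon> * real (card (rcosets H))"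
    proof -
      let ?Q = "{(u, t) \<in> (rcosets H) \<times> T. u #> t \<in> rcosets H \<and> \<kappa> u \<noteq> \<kappa> (u #> t)}"
      have fQ: "finite ?Q" by (rule finite_subset[of _ "(rcosets H) \<times> T"]) (use H assms(3) in auto)
      have "{u\<in>rcosets H. \<exists>t\<in>T. \<kappa> (u #> t) \<noteq> \<kappa> u} \<subseteq> fst ` ?Q"
        using rcosets_r_coset[OF H(1)] assms(4) by (force simp: image_iff)
      then have "card {u\<in>rcosets H. \<exists>t\<in>T. \<kappa> (u #> t) \<noteq> \<kappa> u} \<le> card ?Q"
        using fQ by (meson card_image_le card_mono finite_imageI le_trans)
      also note \<kappa>(2)
      also have "2 * \<delta> * real (card T) \<le> \<epsilon>" using assms(5) by (simp add: \<delta>_def field_simps)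
      then have "2 * \<delta> * real (card T) * real (card (rcosets H)) \<le> \<epsilon> * real (card (rcosets H))"
        by (rule mult_right_mono) simp
      finally show ?thesis by simp
    qed
    ultimately show "\<exists>\<kappa> :: 'a set \<Rightarrow> 'a set set. (\<forall>u\<in>rcosets H. card {v\<in>rcosets H. \<kappa> v = \<kappa> u} \<le> card F) \<and>
      real (card {u\<in>rcosets H. \<exists>t\<in>T. \<kappa> (u #> t) \<noteq> \<kappa> u}) \<le> \<epsilon> * real (card (rcosets H))" by blast
  qed
qed

section \<open>Presentations and cocycles\<close>

locale presented = group G for G (structure) +
  fixes S :: "'a set" and R :: "('a \<times> bool) list set"
  assumes fin_S: "finite S" and S_sub: "S \<subseteq> carrier G" and gen_S: "generate G S = carrier G"
    and fin_R: "finite R" and R_letters: "r \<in> R \<Longrightarrow> set r \<subseteq> S \<times> UNIV"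
    and pres: "set w \<subseteq> S \<times> UNIV \<Longrightarrow> word_eval G w = \<one> \<longleftrightarrow> pres_eq R w []"
begin

text \<open>Letters outside \<open>S\<close> may occur in the middle of a derivation of \<^const>\<open>pres_eq\<close>;
  they act trivially.\<close>

definition letter :: "'a \<times> bool \<Rightarrow> 'a" where
  "letter l = (if fst l \<in> S then (if snd l then fst l else inv (fst l)) else \<one>)"

primrec ev :: "('a \<times> bool) list \<Rightarrow> 'a" where
  "ev [] = \<one>"
| "ev (l # w) = letter l \<otimes> ev w"

definition T :: "'a set" where "T = S \<union> m_inv G ` S"

lemma fin_T: "finite T" using fin_S by (simp add: T_def)

lemma T_sub: "t \<in> T \<Longrightarrow> t \<in> carrier G" using S_sub by (auto simp: T_def)

lemma T_inv: "t \<in> T \<Longrightarrow> inv t \<in> T" using S_sub by (auto simp: T_def)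

lemma letter_closed [simp]: "letter l \<in> carrier G" using S_sub by (auto simp: letter_def)

lemma letter_T: "fst l \<in> S \<Longrightarrow> letter l \<in> T" by (auto simp: letter_def T_def)

lemma letter_flip: "letter (x, \<not> b) = inv (letter (x, b))" using S_sub by (auto simp: letter_def)

lemma T_letter:
  assumes "t \<in> T" shows "\<exists>l. fst l \<in> S \<and> letter l = t"
proof -
  from assms consider "t \<in> S" | x where "x \<in> S" "t = inv x" by (auto simp: T_def)
  then show ?thesis
  proof cases
    case 1
    then show ?thesis by (intro exI[of _ "(t, True)"]) (simp add: letter_def)
  next
    case 2
    then show ?thesis by (intro exI[of _ "(x, False)"]) (simp add: letter_def)
  qed
qed

lemma ev_closed [simp]: "ev w \<in> carrier G" by (induction w) auto

lemma ev_append: "ev (u @ v) = ev u \<otimes> ev v" by (induction u) (auto simp: m_assoc)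

lemma ev_word_eval: "set w \<subseteq> S \<times> UNIV \<Longrightarrow> ev w = word_eval G w"
  by (induction w) (auto simp: word_eval_def letter_def)

lemma ev_take_Suc: "i < length w \<Longrightarrow> ev (take (Suc i) w) = ev (take i w) \<otimes> letter (w ! i)"
  by (simp add: take_Suc_conv_app_nth ev_append)

lemma word_exists: "g \<in> carrier G \<Longrightarrow> \<exists>w. set w \<subseteq> S \<times> UNIV \<and> ev w = g"
proof -
  assume "g \<in> carrier G"
  then have "g \<in> generate G S" by (simp add: gen_S)
  then show ?thesis
  proof induction
    case one
    then show ?case by (intro exI[of _ "[]"]) simp
  next
    case (incl h)
    then show ?case using S_sub by (intro exI[of _ "[(h, True)]"]) (auto simp: letter_def)
  next
    case (inv h)
    then show ?case using S_sub by (intro exI[of _ "[(h, False)]"]) (auto simp: letter_def)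
  next
    case (eng h1 h2)
    then show ?case by (metis ev_append set_append Un_least)
  qed
qed

text \<open>Connectedness of the Cayley graph, phrased as an induction rule with an arbitrary
  starting vertex.\<close>

lemma walk_induct [consumes 2, case_names base step]:
  assumes "g0 \<in> carrier G" "g \<in> carrier G" "Q g0"
    and step: "\<And>x t. x \<in> carrier G \<Longrightarrow> t \<in> T \<Longrightarrow> Q x \<Longrightarrow> Q (x \<otimes> t)"
  shows "Q g"
proof -
  obtain w where w: "set w \<subseteq> S \<times> UNIV" "ev w = inv g0 \<otimes> g" using word_exists[of "inv g0 \<otimes> g"] assms by auto
  have "Q (x \<otimes> ev w)" if "x \<in> carrier G" "Q x" for x
    using w(1) that
  proof (induction w arbitrary: x)
    case (Cons l w)
    have "Q ((x \<otimes> letter l) \<otimes> ev w)" using Cons.prems by (intro Cons.IH step letter_T) auto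
    then show ?case using Cons.prems by (simp add: m_assoc)
  qed simp
  from this[OF assms(1,3)] show ?thesis using assms(1,2) w by (simp add: m_assoc[symmetric])
qed

definition flip :: "('a \<times> bool) list \<Rightarrow> ('a \<times> bool) list" where
  "flip w = rev (map (\<lambda>(x, b). (x, \<not> b)) w)"

lemma length_flip [simp]: "length (flip w) = length w" by (simp add: flip_def)

lemma set_flip: "set w \<subseteq> S \<times> UNIV \<Longrightarrow> set (flip w) \<subseteq> S \<times> UNIV" by (auto simp: flip_def)

lemma ev_flip: "ev (flip w) = inv (ev w)"
proof (induction w)
  case (Cons l w)
  obtain x b where l: "l = (x, b)" by force
  have "ev (flip (l # w)) = ev (flip w) \<otimes> letter (x, \<not> b)" by (simp add: flip_def l ev_append)
  then show ?case using Cons by (simp only: letter_flip l ev.simps inv_mult_group letter_closed ev_closed)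
qed (simp add: flip_def)

text \<open>The sum bounds all relator lengths at once; \<open>Suc\<close> keeps the radius
  positive, so that generators lie in \<open>B\<close> even without relators.\<close>

definition radius :: nat where "radius = Suc (\<Sum>r\<in>R. length r)"

text \<open>Two vertices of a relator loop are joined through the base point of the loop by a word
  of at most twice the relator length; hence the factor two.\<close>

definition B :: "'a set" where "B = ev ` {w. set w \<subseteq> S \<times> UNIV \<and> length w \<le> 2 * radius}"

lemma length_le_radius: "r \<in> R \<Longrightarrow> length r \<le> radius"
  using member_le_sum[of r R length] fin_R by (simp add: radius_def)

lemma fin_B: "finite B"
  unfolding B_def using fin_S by (intro finite_imageI finite_lists_length_le) simp

lemma B_sub: "b \<in> B \<Longrightarrow> b \<in> carrier G" by (auto simp: B_def)

lemma B_inv: "b \<in> B \<Longrightarrow> inv b \<in> B"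
  unfolding B_def using set_flip ev_flip[symmetric] by (auto intro!: image_eqI)

lemma ev_in_B: "set w \<subseteq> S \<times> UNIV \<Longrightarrow> length w \<le> 2 * radius \<Longrightarrow> ev w \<in> B"
  by (auto simp: B_def)

lemma T_B: "t \<in> T \<Longrightarrow> t \<in> B"
proof -
  assume "t \<in> T"
  then obtain l where "fst l \<in> S" "letter l = t" using T_letter by blast
  then show "t \<in> B" using ev_in_B[of "[l]"] by (auto simp: radius_def mem_Times_iff)
qed

lemma relator_diff_B:
  assumes "r \<in> R" shows "inv (ev (take i r)) \<otimes> ev (take j r) \<in> B"
proof -
  have "set (take k r) \<subseteq> S \<times> UNIV" for k using R_letters[OF assms] set_take_subset[of k r] by blast
  then have "ev (flip (take i r) @ take j r) \<in> B"
    using length_le_radius[OF assms] set_flip by (intro ev_in_B) auto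
  then show ?thesis by (simp add: ev_append ev_flip)
qed

lemma ev_relator:
  assumes "r \<in> R" shows "ev r = \<one>"
proof -
  have "pres_eq R r []" using pres_eq.rel[OF assms, of "[]" "[]"] by (auto intro: pres_eq.sym)
  then show ?thesis using pres ev_word_eval R_letters[OF assms] by simp
qed

section \<open>Sums along paths and simple connectivity of the Cayley complex\<close>

primrec psum :: "('a \<Rightarrow> 'a \<Rightarrow> int) \<Rightarrow> 'a \<Rightarrow> ('a \<times> bool) list \<Rightarrow> int" where
  "psum d g [] = 0"
| "psum d g (l # w) = d g (g \<otimes> letter l) + psum d (g \<otimes> letter l) w"

lemma psum_append: "g \<in> carrier G \<Longrightarrow> psum d g (u @ v) = psum d g u + psum d (g \<otimes> ev u) v"
  by (induction u arbitrary: g) (auto simp: m_assoc)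

lemma psum_telescope:
  assumes "g \<in> carrier G"
    "\<And>i. i < length w \<Longrightarrow> d (g \<otimes> ev (take i w)) (g \<otimes> ev (take (Suc i) w))
      = e (g \<otimes> ev (take (Suc i) w)) - e (g \<otimes> ev (take i w))"
  shows "psum d g w = e (g \<otimes> ev w) - e g"
  using assms
proof (induction w arbitrary: g)
  case (Cons l w)
  have "psum d (g \<otimes> letter l) w = e ((g \<otimes> letter l) \<otimes> ev w) - e (g \<otimes> letter l)"
  proof (rule Cons.IH)
    fix i assume "i < length w"
    then show "d (g \<otimes> letter l \<otimes> ev (take i w)) (g \<otimes> letter l \<otimes> ev (take (Suc i) w))
      = e (g \<otimes> letter l \<otimes> ev (take (Suc i) w)) - e (g \<otimes> letter l \<otimes> ev (take i w))"
      using Cons.prems(2)[of "Suc i"] Cons.prems(1) by (simp add: m_assoc)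
  qed (use Cons.prems in simp)
  moreover have "d g (g \<otimes> letter l) = e (g \<otimes> letter l) - e g"
    using Cons.prems(2)[of 0] Cons.prems(1) by simp
  ultimately show ?case using Cons.prems(1) by (simp add: m_assoc)
qed simp

text \<open>A cocycle on the Cayley graph whose sum around every relator vanishes has a potential, because
  the Cayley complex is simply connected.\<close>

lemma cocycle_potential:
  fixes d :: "'a \<Rightarrow> 'a \<Rightarrow> int"
  assumes g0: "g0 \<in> carrier G"
    and diag: "\<And>g. g \<in> carrier G \<Longrightarrow> d g g = 0"
    and anti: "\<And>g t. g \<in> carrier G \<Longrightarrow> t \<in> T \<Longrightarrow> d (g \<otimes> t) g = - d g (g \<otimes> t)"
    and loop: "\<And>g r. g \<in> carrier G \<Longrightarrow> r \<in> R \<Longrightarrow> psum d g r = 0"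
  shows "\<exists>f. f g0 = k \<and> (\<forall>g\<in>carrier G. \<forall>t\<in>T. f (g \<otimes> t) = f g + d g (g \<otimes> t))"
proof -
  \<comment> \<open>A letter outside \<open>S\<close> evaluates to one, so its edge is a loop, which
    \<open>diag\<close> covers.\<close>
  have anti': "d (g \<otimes> letter l) g = - d g (g \<otimes> letter l)" if "g \<in> carrier G" for g l
  proof (cases "fst l \<in> S")
    case True
    then show ?thesis using anti[OF that letter_T] by blast
  next
    case False
    then show ?thesis using that diag by (simp add: letter_def)
  qed
  \<comment> \<open>Derivation steps preserve path sums: a backtrack cancels by antisymmetry, and an
    inserted relator sums to zero wherever it is based.\<close>
  have inv_pres: "ev u = ev v \<and> (\<forall>g\<in>carrier G. psum d g u = psum d g v)" if "pres_eq R u v" for u v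
    using that
  proof induction
    case (free u v x b)
    have c: "letter (x, b) \<otimes> (letter (x, \<not> b) \<otimes> y) = y" if "y \<in> carrier G" for y
      using that by (simp add: letter_flip m_assoc[symmetric])
    have "psum d g (u @ v) = psum d g (u @ [(x, b), (x, \<not> b)] @ v)" if g: "g \<in> carrier G" for g
    proof -
      define h where "h = g \<otimes> ev u"
      have h: "h \<in> carrier G" using g by (simp add: h_def)
      have ret: "h \<otimes> letter (x, b) \<otimes> letter (x, \<not> b) = h"
        using h by (simp add: letter_flip m_assoc)
      have "psum d h ([(x, b), (x, \<not> b)] @ v) = d h (h \<otimes> letter (x, b)) + (d (h \<otimes> letter (x, b)) h + psum d h v)"
        using ret by simp
      also have "\<dots> = psum d h v" using anti'[OF h] by simp
      finally show ?thesis using g by (simp only: psum_append h_def)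
    qed
    then show ?case using c by (simp add: ev_append)
  next
    case (rel r u v)
    then show ?case using ev_relator loop by (simp add: ev_append psum_append)
  qed auto
  \<comment> \<open>Followed by the reverse of \<open>v\<close>, each word is trivial in the group,
    hence derivable to the empty word; the return path contributes the same to both sums.\<close>
  have psum_eq: "psum d g0 u = psum d g0 v"
    if uv: "set u \<subseteq> S \<times> UNIV" "set v \<subseteq> S \<times> UNIV" "ev u = ev v" for u v
  proof -
    have "psum d g0 w + psum d (g0 \<otimes> ev w) (flip v) = 0" if w: "set w \<subseteq> S \<times> UNIV" "ev w = ev v" for w
    proof -
      have "set (w @ flip v) \<subseteq> S \<times> UNIV" using w set_flip[OF uv(2)] by simp
      moreover have "ev (w @ flip v) = \<one>" using w by (simp add: ev_append ev_flip)
      ultimately have "pres_eq R (w @ flip v) []" using pres ev_word_eval by metis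
      then have "psum d g0 (w @ flip v) = 0" using inv_pres g0 by force
      then show ?thesis using g0 by (simp add: psum_append)
    qed
    from this[OF uv(1,3)] this[OF uv(2) HOL.refl] uv(3) show ?thesis by simp
  qed
  define word where "word g = (SOME w. set w \<subseteq> S \<times> UNIV \<and> ev w = inv g0 \<otimes> g)" for g
  have word: "set (word g) \<subseteq> S \<times> UNIV" "ev (word g) = inv g0 \<otimes> g" if "g \<in> carrier G" for g
  proof -
    have "\<exists>w. set w \<subseteq> S \<times> UNIV \<and> ev w = inv g0 \<otimes> g" using that g0 by (intro word_exists) auto
    from someI_ex[OF this] show "set (word g) \<subseteq> S \<times> UNIV" "ev (word g) = inv g0 \<otimes> g"
      unfolding word_def by auto
  qed
  define f where "f g = k + psum d g0 (word g)" for g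
  have "f g0 = k" using psum_eq[OF word(1)[OF g0], of "[]"] word(2)[OF g0] g0 by (simp add: f_def)
  moreover have "f (g \<otimes> t) = f g + d g (g \<otimes> t)" if g: "g \<in> carrier G" and t: "t \<in> T" for g t
  proof -
    obtain l where l: "fst l \<in> S" "letter l = t" using T_letter[OF t] by blast
    have "psum d g0 (word (g \<otimes> t)) = psum d g0 (word g @ [l])"
      using word[OF g] word[of "g \<otimes> t"] g T_sub[OF t] l g0
      by (intro psum_eq) (auto simp: ev_append m_assoc mem_Times_iff)
    also have "\<dots> = psum d g0 (word g) + d g (g \<otimes> t)"
      using g g0 l word(2)[OF g] T_sub[OF t] by (simp add: psum_append m_assoc[symmetric])
    finally show ?thesis by (simp add: f_def)
  qed
  ultimately show ?thesis by blast
qed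

lemma path_const:
  assumes "\<And>i. i < length w \<Longrightarrow> h (g \<otimes> ev (take i w)) = h (g \<otimes> ev (take (Suc i) w))"
    and "g \<in> carrier G"
  shows "h (g \<otimes> ev w) = h g"
proof -
  have "i \<le> length w \<Longrightarrow> h (g \<otimes> ev (take i w)) = h g" for i
    by (induction i) (use assms in auto)
  from this[of "length w"] show ?thesis by simp
qed

end

section \<open>Walls and half-spaces\<close>

text \<open>One notion of connected class serves both kinds of tree vertices, so that stabilisers of
  components and of walls can be handled by a single lemma.\<close>

definition cls :: "('a \<times> 'a) set \<Rightarrow> 'a \<Rightarrow> 'a set" where "cls E x = E\<^sup>* `` {x}"

lemma cls_self: "x \<in> cls E x" by (simp add: cls_def)

lemma cls_step: "y \<in> cls E x \<Longrightarrow> (y, z) \<in> E \<Longrightarrow> z \<in> cls E x"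
  by (auto simp: cls_def intro: rtrancl_into_rtrancl)

lemma cls_induct [consumes 1, case_names base step]:
  assumes "y \<in> cls E x" "Q x" "\<And>y z. y \<in> cls E x \<Longrightarrow> Q y \<Longrightarrow> (y, z) \<in> E \<Longrightarrow> Q z"
  shows "Q y"
proof -
  have "(x, y) \<in> E\<^sup>*" using assms(1) by (simp add: cls_def)
  then show ?thesis
  proof induction
    case (step y z)
    then show ?case by (intro assms(3)[of y z]) (simp_all add: cls_def)
  qed (rule assms(2))
qed

lemma cls_eq:
  assumes "sym E" "y \<in> cls E x" shows "cls E y = cls E x"
proof -
  have "(x, y) \<in> E\<^sup>*" "(y, x) \<in> E\<^sup>*"
    using assms sym_rtrancl[OF assms(1)] by (auto simp: cls_def dest: symD)
  then show ?thesis by (auto simp: cls_def intro: rtrancl_trans)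
qed

lemma cls_sub:
  assumes "x \<in> A" "E \<subseteq> A \<times> A" shows "cls E x \<subseteq> A"
proof
  fix y assume "y \<in> cls E x"
  then show "y \<in> A" by (induction rule: cls_induct) (use assms in auto)
qed

lemma (in group) cls_translate:
  assumes "h \<in> carrier G" "g \<in> carrier G" "E \<subseteq> carrier G \<times> carrier G"
    and E: "\<And>x y. (x, y) \<in> E \<Longrightarrow> (h \<otimes> x, h \<otimes> y) \<in> E"
    and E': "\<And>x y. (x, y) \<in> E \<Longrightarrow> (inv h \<otimes> x, inv h \<otimes> y) \<in> E"
  shows "cls E (h \<otimes> g) = (\<otimes>) h ` cls E g"
proof -
  have *: "(\<otimes>) k ` cls E x \<subseteq> cls E (k \<otimes> x)" if "\<And>x y. (x, y) \<in> E \<Longrightarrow> (k \<otimes> x, k \<otimes> y) \<in> E" for k x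
  proof (rule image_subsetI)
    fix y assume "y \<in> cls E x"
    then show "k \<otimes> y \<in> cls E (k \<otimes> x)"
      by (induction rule: cls_induct) (use that in \<open>auto intro: cls_self cls_step\<close>)
  qed
  have "(\<otimes>) (inv h) ` cls E (h \<otimes> g) \<subseteq> cls E (inv h \<otimes> (h \<otimes> g))" using *[OF E'] .
  also have "inv h \<otimes> (h \<otimes> g) = g" using assms by (simp add: m_assoc[symmetric])
  finally have "(\<otimes>) h ` (\<otimes>) (inv h) ` cls E (h \<otimes> g) \<subseteq> (\<otimes>) h ` cls E g" by (rule image_mono)
  moreover have "(\<otimes>) h ` (\<otimes>) (inv h) ` A = A" if "A \<subseteq> carrier G" for A
  proof -
    have "h \<otimes> (inv h \<otimes> a) = a" if "a \<in> A" for a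
      using that \<open>A \<subseteq> carrier G\<close> assms(1) by (auto simp: m_assoc[symmetric])
    then show ?thesis by (force simp: image_image)
  qed
  moreover have "cls E (h \<otimes> g) \<subseteq> carrier G" using assms by (intro cls_sub) auto
  ultimately have "cls E (h \<otimes> g) \<subseteq> (\<otimes>) h ` cls E g" by simp
  then show ?thesis using *[OF E, of g] by (rule equalityI)
qed

text \<open>\<open>\<kappa>\<close> is the lift of a colouring of the cosets \<open>H #> g\<close>.
  Components, walls and half-spaces built from it are permuted by left translation with elements of
  \<open>H\<close>.\<close>

locale coloured = presented +
  fixes H :: "'a set" and \<kappa> :: "'a \<Rightarrow> 'k"
  assumes H_sub: "subgroup H G" and \<kappa>_inv: "h \<in> H \<Longrightarrow> g \<in> carrier G \<Longrightarrow> \<kappa> (h \<otimes> g) = \<kappa> g"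
begin

definition bd :: "'a set" where "bd = {g \<in> carrier G. \<exists>t\<in>T. \<kappa> (g \<otimes> t) \<noteq> \<kappa> g}"

definition EP :: "('a \<times> 'a) set" where
  "EP = {(g, g \<otimes> t) |g t. g \<in> carrier G \<and> t \<in> T \<and> \<kappa> (g \<otimes> t) = \<kappa> g}"

text \<open>With steps from \<open>B\<close> rather than \<open>T\<close>, boundary vertices on a
  common relator loop belong to one wall; this keeps different walls apart. A wall contains boundary
  vertices on all of its sides.\<close>

definition EC :: "('a \<times> 'a) set" where "EC = {(g, g \<otimes> b) |g b. g \<in> bd \<and> b \<in> B \<and> g \<otimes> b \<in> bd}"

definition comp :: "'a \<Rightarrow> 'a set" where "comp = cls EP"

definition wall :: "'a \<Rightarrow> 'a set" where "wall = cls EC"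

lemma H_carrier: "h \<in> H \<Longrightarrow> h \<in> carrier G" using subgroup.subset[OF H_sub] by auto

lemma H_inv: "h \<in> H \<Longrightarrow> inv h \<in> H" using subgroup.m_inv_closed[OF H_sub] .

lemma bd_carrier: "g \<in> bd \<Longrightarrow> g \<in> carrier G" by (simp add: bd_def)

lemma EP_sub: "EP \<subseteq> carrier G \<times> carrier G" using T_sub by (auto simp: EP_def)

lemma EC_sub: "EC \<subseteq> bd \<times> bd" by (auto simp: EC_def)

lemma EC_I: "x \<in> bd \<Longrightarrow> b \<in> B \<Longrightarrow> x \<otimes> b \<in> bd \<Longrightarrow> (x, x \<otimes> b) \<in> EC"
  by (auto simp: EC_def)

lemma sym_EP: "sym EP"
proof (rule symI)
  fix x y assume "(x, y) \<in> EP"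
  then obtain t where t: "x \<in> carrier G" "t \<in> T" "y = x \<otimes> t" "\<kappa> y = \<kappa> x" by (auto simp: EP_def)
  then have "y \<in> carrier G" "y \<otimes> inv t = x" using T_sub[OF t(2)] by (auto simp: m_assoc)
  then show "(y, x) \<in> EP" using t T_inv[OF t(2)] by (force simp: EP_def)
qed

lemma sym_EC: "sym EC"
proof (rule symI)
  fix x y assume "(x, y) \<in> EC"
  then obtain b where b: "x \<in> bd" "y \<in> bd" "b \<in> B" "y = x \<otimes> b" by (auto simp: EC_def)
  then have "y \<otimes> inv b = x" using B_sub[OF b(3)] bd_carrier[OF b(1)] by (simp add: m_assoc)
  then show "(y, x) \<in> EC" using b B_inv[OF b(3)] by (force simp: EC_def)
qed

lemma bd_translate: "h \<in> H \<Longrightarrow> g \<in> bd \<Longrightarrow> h \<otimes> g \<in> bd"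
  using H_carrier \<kappa>_inv T_sub by (auto simp: bd_def m_assoc)

lemma EP_translate:
  assumes h: "h \<in> H" and "(x, y) \<in> EP" shows "(h \<otimes> x, h \<otimes> y) \<in> EP"
proof -
  obtain t where t: "x \<in> carrier G" "t \<in> T" "y = x \<otimes> t" "\<kappa> y = \<kappa> x" using assms by (auto simp: EP_def)
  then have "h \<otimes> y = (h \<otimes> x) \<otimes> t" using H_carrier[OF h] T_sub[OF t(2)] by (simp add: m_assoc)
  moreover have "\<kappa> (h \<otimes> y) = \<kappa> (h \<otimes> x)" using \<kappa>_inv[OF h] t T_sub[OF t(2)] by simp
  ultimately show ?thesis using t H_carrier[OF h] by (auto simp: EP_def)
qed

lemma EC_translate:
  assumes h: "h \<in> H" and "(x, y) \<in> EC" shows "(h \<otimes> x, h \<otimes> y) \<in> EC"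
proof -
  obtain b where b: "x \<in> bd" "y \<in> bd" "b \<in> B" "y = x \<otimes> b" using assms by (auto simp: EC_def)
  then have "h \<otimes> y = (h \<otimes> x) \<otimes> b" using H_carrier[OF h] B_sub[OF b(3)] bd_carrier[OF b(1)] by (simp add: m_assoc)
  moreover have "h \<otimes> x \<in> bd" "h \<otimes> y \<in> bd" using b bd_translate[OF h] by auto
  ultimately show ?thesis using b(3) by (auto simp: EC_def)
qed

lemma comp_self: "g \<in> comp g" and wall_self: "g \<in> wall g"
  by (simp_all add: comp_def wall_def cls_self)

lemma EP_comp: "(x, y) \<in> EP \<Longrightarrow> y \<in> comp x" and EC_wall: "(x, y) \<in> EC \<Longrightarrow> y \<in> wall x"
  by (simp_all add: comp_def wall_def cls_step[OF cls_self])

lemma comp_eq: "y \<in> comp x \<Longrightarrow> comp y = comp x"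
  unfolding comp_def by (rule cls_eq[OF sym_EP])

lemma wall_eq: "y \<in> wall x \<Longrightarrow> wall y = wall x"
  unfolding wall_def by (rule cls_eq[OF sym_EC])

lemma comp_sub: "g \<in> carrier G \<Longrightarrow> comp g \<subseteq> carrier G"
  unfolding comp_def by (rule cls_sub[OF _ EP_sub])

lemma wall_sub: "g \<in> bd \<Longrightarrow> wall g \<subseteq> bd"
  unfolding wall_def by (rule cls_sub[OF _ EC_sub])

lemma comp_translate: "h \<in> H \<Longrightarrow> g \<in> carrier G \<Longrightarrow> comp (h \<otimes> g) = (\<otimes>) h ` comp g"
  unfolding comp_def using H_carrier H_inv EP_translate EP_sub by (intro cls_translate) auto

lemma wall_translate: "h \<in> H \<Longrightarrow> g \<in> bd \<Longrightarrow> wall (h \<otimes> g) = (\<otimes>) h ` wall g"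
  unfolding wall_def using H_carrier H_inv EC_translate EC_sub bd_carrier by (intro cls_translate) auto

lemma comp_colour:
  assumes "y \<in> comp x" shows "\<kappa> y = \<kappa> x"
  using assms unfolding comp_def by (induction rule: cls_induct) (auto simp: EP_def)

text \<open>A change of component along an edge is a change of colour. Both ends see it because
  \<open>T\<close> is closed under inverses, and they share a wall because \<open>T\<close> is
  contained in \<open>B\<close>.\<close>

lemma bd_step:
  assumes "g \<in> carrier G" "t \<in> T" "comp (g \<otimes> t) \<noteq> comp g"
  shows "g \<in> bd" "g \<otimes> t \<in> bd" "g \<otimes> t \<in> wall g"
proof -
  have t: "t \<in> carrier G" "inv t \<in> T" "g \<otimes> t \<otimes> inv t = g" using assms T_sub T_inv by (auto simp: m_assoc)
  have neq: "\<kappa> (g \<otimes> t) \<noteq> \<kappa> g"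
  proof
    assume "\<kappa> (g \<otimes> t) = \<kappa> g"
    then have "(g, g \<otimes> t) \<in> EP" using assms by (auto simp: EP_def)
    then show False using comp_eq[OF EP_comp] assms by blast
  qed
  show bd1: "g \<in> bd" using neq assms by (auto simp: bd_def)
  have "\<kappa> (g \<otimes> t \<otimes> inv t) \<noteq> \<kappa> (g \<otimes> t)" using neq t by simp
  moreover have "g \<otimes> t \<in> carrier G" using assms(1) t(1) by simp
  ultimately show bd2: "g \<otimes> t \<in> bd" using t(2) unfolding bd_def by blast
  show "g \<otimes> t \<in> wall g" using bd1 bd2 T_B[OF assms(2)] by (intro EC_wall) (auto simp: EC_def)
qed

lemma mem_comp_iff: "y \<in> comp x \<longleftrightarrow> comp y = comp x"
  using comp_eq comp_self by metis

lemma mem_wall_iff: "y \<in> wall x \<longleftrightarrow> wall y = wall x"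
  using wall_eq wall_self by metis

lemma short_path_wall:
  assumes g: "g \<in> bd" and w: "set w \<subseteq> S \<times> UNIV" "length w \<le> 2 * radius"
    and i: "g \<otimes> ev (take i w) \<in> bd"
  shows "g \<otimes> ev (take i w) \<in> wall g"
proof -
  have "ev (take i w) \<in> B" using w by (intro ev_in_B) (auto dest: in_set_takeD)
  then have "(g, g \<otimes> ev (take i w)) \<in> EC" using g i by (auto simp: EC_def)
  then show ?thesis by (rule EC_wall)
qed

lemma path_step:
  assumes "g \<in> carrier G" "set w \<subseteq> S \<times> UNIV" "i < length w"
  shows "\<exists>t\<in>T. g \<otimes> ev (take (Suc i) w) = g \<otimes> ev (take i w) \<otimes> t"
proof -
  have "w ! i \<in> S \<times> UNIV" using assms nth_mem by blast
  then have "letter (w ! i) \<in> T" by (auto intro: letter_T)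
  then show ?thesis using assms by (intro bexI[of _ "letter (w ! i)"]) (simp_all add: ev_take_Suc m_assoc)
qed

text \<open>Neighbours on a wall are joined by a path so short that it meets no other wall.\<close>

lemma constant_on_wall:
  assumes x: "x \<in> bd" and y: "y \<in> wall x"
    and const: "\<And>g t. g \<in> carrier G \<Longrightarrow> t \<in> T \<Longrightarrow> (g \<in> bd \<longrightarrow> g \<in> wall x) \<Longrightarrow> (g \<otimes> t \<in> bd \<longrightarrow> g \<otimes> t \<in> wall x)
      \<Longrightarrow> h (g \<otimes> t) = h g"
  shows "h y = h x"
proof -
  have "y \<in> cls EC x" using y by (simp add: wall_def)
  then show ?thesis
  proof (induction rule: cls_induct)
    case (step y z)
    then obtain b where b: "y \<in> bd" "z = y \<otimes> b" "b \<in> B" by (auto simp: EC_def)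
    then obtain w where w: "set w \<subseteq> S \<times> UNIV" "length w \<le> 2 * radius" "b = ev w" by (auto simp: B_def)
    have wy: "wall y = wall x" using step(1) wall_eq by (simp add: wall_def)
    have yc: "y \<in> carrier G" using b bd_carrier by simp
    have "h (y \<otimes> ev w) = h y"
    proof (rule path_const[OF _ yc])
      fix i assume i: "i < length w"
      obtain t where t: "t \<in> T" "y \<otimes> ev (take (Suc i) w) = y \<otimes> ev (take i w) \<otimes> t"
        using path_step[OF yc w(1) i] by blast
      show "h (y \<otimes> ev (take i w)) = h (y \<otimes> ev (take (Suc i) w))"
        unfolding t(2) using short_path_wall[OF b(1) w(1,2)] yc t wy
        by (intro const[symmetric]) (auto simp flip: t(2))
    qed
    then show ?case using step b w by simp
  qed simp
qed

text \<open>The branch of the tree at the edge between \<open>P\<close> and \<open>c\<close>, on the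
  side of \<open>P\<close>: membership is prescribed on the wall and may change only along edges
  with both ends there. Since \<open>P\<close> can meet \<open>c\<close> in many places, consistency
  is a genuine question.\<close>

definition is_hs :: "'a set \<Rightarrow> 'a set \<Rightarrow> 'a set \<Rightarrow> bool" where
  "is_hs P c Y \<longleftrightarrow> Y \<subseteq> carrier G \<and> (\<forall>g\<in>c. g \<in> Y \<longleftrightarrow> g \<in> P) \<and>
    (\<forall>g\<in>carrier G. \<forall>t\<in>T. \<not> (g \<in> c \<and> g \<otimes> t \<in> c) \<longrightarrow> (g \<otimes> t \<in> Y \<longleftrightarrow> g \<in> Y))"

text \<open>The jumps of the indicator \<open>e\<close> of the component across this wall form a
  cocycle: a relator loop meeting the wall has no boundary vertex on another one, so there
  \<open>d\<close> is the gradient of \<open>e\<close>, and on all other loops it vanishes. The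
  half-space is where the potential equals one.\<close>

lemma ex_hs:
  assumes x: "x \<in> bd" shows "\<exists>Y. is_hs (comp x) (wall x) Y"
proof -
  define e :: "'a \<Rightarrow> int" where "e g = (if g \<in> comp x then 1 else 0)" for g
  define d where "d g g' = (if g \<in> wall x then e g' - e g else 0)" for g g'
  have e_step: "e (g \<otimes> t) = e g"
    if "g \<in> carrier G" "t \<in> T" "\<not> (g \<in> bd \<and> g \<otimes> t \<in> bd)" for g t
  proof -
    have "comp (g \<otimes> t) = comp g" using that bd_step(1,2) by blast
    then show ?thesis by (simp add: e_def mem_comp_iff)
  qed
  \<comment> \<open>Although \<open>d\<close> tests only its first argument, a jump of
    \<open>e\<close> never has just one end on the wall; this gives antisymmetry.\<close>
  have wall_edge: "e (g \<otimes> t) = e g \<or> (g \<in> wall x \<longleftrightarrow> g \<otimes> t \<in> wall x)" if "g \<in> carrier G" "t \<in> T" for g t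
  proof (cases "comp (g \<otimes> t) = comp g")
    case True
    then show ?thesis by (simp add: e_def mem_comp_iff)
  next
    case False
    from bd_step(3)[OF that this] show ?thesis by (simp add: mem_wall_iff)
  qed
  have "\<exists>f. f x = 1 \<and> (\<forall>g\<in>carrier G. \<forall>t\<in>T. f (g \<otimes> t) = f g + d g (g \<otimes> t))"
  proof (rule cocycle_potential)
    show "x \<in> carrier G" using x bd_carrier by blast
    show "d g g = 0" for g by (simp add: d_def)
    show "d (g \<otimes> t) g = - d g (g \<otimes> t)" if "g \<in> carrier G" "t \<in> T" for g t
      using wall_edge[OF that] by (auto simp: d_def)
    fix g r assume g: "g \<in> carrier G" and r: "r \<in> R"
    show "psum d g r = 0"
    proof (cases "\<exists>i. g \<otimes> ev (take i r) \<in> wall x")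
      case True
      then obtain i where i: "g \<otimes> ev (take i r) \<in> wall x" by blast
      \<comment> \<open>Vertices of one relator loop differ by an element of \<open>B\<close>, so
        all boundary vertices of this loop lie on the wall.\<close>
      have on_wall: "g \<otimes> ev (take j r) \<in> wall x" if "g \<otimes> ev (take j r) \<in> bd" for j
      proof -
        have "g \<otimes> ev (take j r) = g \<otimes> ev (take i r) \<otimes> (inv (ev (take i r)) \<otimes> ev (take j r))"
          using g by (simp add: m_assoc) (simp add: m_assoc[symmetric])
        then have "(g \<otimes> ev (take i r), g \<otimes> ev (take j r)) \<in> EC"
          using EC_I[OF subsetD[OF wall_sub[OF x] i] relator_diff_B[OF r]] that by metis
        from cls_step[OF i[unfolded wall_def] this] show ?thesis by (simp only: wall_def)
      qed
      have "psum d g r = e (g \<otimes> ev r) - e g"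
      proof (rule psum_telescope[OF g])
        fix j assume j: "j < length r"
        obtain t where t: "t \<in> T" "g \<otimes> ev (take (Suc j) r) = g \<otimes> ev (take j r) \<otimes> t"
          using path_step[OF g R_letters[OF r] j] by blast
        show "d (g \<otimes> ev (take j r)) (g \<otimes> ev (take (Suc j) r))
          = e (g \<otimes> ev (take (Suc j) r)) - e (g \<otimes> ev (take j r))"
          using on_wall[of j] e_step[of "g \<otimes> ev (take j r)" t] g t by (auto simp: d_def)
      qed
      then show ?thesis using ev_relator[OF r] g by simp
    next
      case False
      have "psum d g r = (\<lambda>_. 0) (g \<otimes> ev r) - (\<lambda>_. 0) g"
        by (rule psum_telescope[OF g]) (use False in \<open>auto simp: d_def\<close>)
      then show ?thesis by simp
    qed
  qed
  then obtain f where f: "f x = 1" "\<And>g t. g \<in> carrier G \<Longrightarrow> t \<in> T \<Longrightarrow> f (g \<otimes> t) = f g + d g (g \<otimes> t)"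
    by blast
  have f_wall: "f y = e y" if y: "y \<in> wall x" for y
  proof -
    \<comment> \<open>Along the short paths that link neighbours on the wall, \<open>f\<close> and
      \<open>e\<close> have the same increments.\<close>
    have "f y - e y = f x - e x"
    proof (rule constant_on_wall[where h="\<lambda>y. f y - e y", OF x y])
      fix g t assume "g \<in> carrier G" "t \<in> T" "g \<in> bd \<longrightarrow> g \<in> wall x"
      then show "f (g \<otimes> t) - e (g \<otimes> t) = f g - e g"
        using f(2)[of g t] e_step[of g t] by (auto simp: d_def)
    qed
    then show ?thesis using f(1) comp_self[of x] by (simp add: e_def)
  qed
  \<comment> \<open>Away from the wall the potential is constant, and at a wall vertex it is pinned
    to \<open>e\<close>; repeated crossings therefore cannot accumulate.\<close>
  have f_01: "f g = 0 \<or> f g = 1" if "g \<in> carrier G" for g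
    using bd_carrier[OF x] that
  proof (induction rule: walk_induct)
    case base
    then show ?case using f by simp
  next
    case (step g t)
    then show ?case using f(2)[of g t] f_wall[of g] by (auto simp: d_def e_def)
  qed
  define Y where "Y = {g \<in> carrier G. f g = 1}"
  have "is_hs (comp x) (wall x) Y" unfolding is_hs_def
  proof (intro conjI ballI impI)
    show "Y \<subseteq> carrier G" by (auto simp: Y_def)
    show "g \<in> Y \<longleftrightarrow> g \<in> comp x" if "g \<in> wall x" for g
      using f_wall[OF that] that wall_sub[OF x] bd_carrier by (auto simp: Y_def e_def)
    fix g t assume gt: "g \<in> carrier G" "t \<in> T" "\<not> (g \<in> wall x \<and> g \<otimes> t \<in> wall x)"
    then have "d g (g \<otimes> t) = 0" using wall_edge[OF gt(1,2)] by (auto simp: d_def)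
    then show "g \<otimes> t \<in> Y \<longleftrightarrow> g \<in> Y" using f(2)[OF gt(1,2)] gt T_sub by (auto simp: Y_def)
  qed
  then show ?thesis by blast
qed

lemma hs_unique:
  assumes c: "c \<subseteq> carrier G" "x \<in> c" and Y: "is_hs P c Y" and Z: "is_hs P c Z"
  shows "Y = Z"
proof -
  have "g \<in> Y \<longleftrightarrow> g \<in> Z" if g: "g \<in> carrier G" for g
  proof -
    have "x \<in> carrier G" using c by auto
    then show ?thesis using g
    proof (induction rule: walk_induct)
      case base
      then show ?case using Y Z c(2) by (simp add: is_hs_def)
    next
      case (step g t)
      show ?case
      proof (cases "g \<in> c \<and> g \<otimes> t \<in> c")
        case True
        then show ?thesis using Y Z by (simp add: is_hs_def)
      next
        case False
        then show ?thesis using Y Z step unfolding is_hs_def by metis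
      qed
    qed
  qed
  then show ?thesis using Y Z by (auto simp: is_hs_def)
qed

text \<open>The half-space on the \<open>P\<close>-side of the wall \<open>c\<close>.\<close>

definition hs :: "'a set \<Rightarrow> 'a set \<Rightarrow> 'a set" where "hs P c = (SOME Y. is_hs P c Y)"

definition incident :: "'a set \<Rightarrow> 'a set \<Rightarrow> bool" where
  "incident P c \<longleftrightarrow> (\<exists>x\<in>bd. P = comp x \<and> c = wall x)"

lemma is_hs_hs: "incident P c \<Longrightarrow> is_hs P c (hs P c)"
  unfolding incident_def hs_def by (metis ex_hs someI_ex)

lemma hs_sub: "incident P c \<Longrightarrow> hs P c \<subseteq> carrier G"
  using is_hs_hs by (simp add: is_hs_def)

lemma hs_wall: "incident P c \<Longrightarrow> g \<in> c \<Longrightarrow> g \<in> hs P c \<longleftrightarrow> g \<in> P"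
  using is_hs_hs by (simp add: is_hs_def)

lemma hs_step:
  "incident P c \<Longrightarrow> g \<in> carrier G \<Longrightarrow> t \<in> T \<Longrightarrow> \<not> (g \<in> c \<and> g \<otimes> t \<in> c) \<Longrightarrow> g \<otimes> t \<in> hs P c \<longleftrightarrow> g \<in> hs P c"
  using is_hs_hs by (simp add: is_hs_def)

lemma incident_eq:
  assumes "incident P c" shows "y \<in> P \<Longrightarrow> P = comp y" "y \<in> c \<Longrightarrow> c = wall y" "y \<in> c \<Longrightarrow> y \<in> bd"
  using assms comp_eq wall_eq subsetD[OF wall_sub] by (auto simp: incident_def)

lemma hs_comp:
  assumes inc: "incident P c" shows "P \<subseteq> hs P c"
proof
  fix y assume y: "y \<in> P"
  obtain x where x: "x \<in> bd" "P = comp x" "c = wall x" using inc by (auto simp: incident_def)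
  have "y \<in> cls EP x" using y x by (simp add: comp_def)
  then show "y \<in> hs P c"
  proof (induction rule: cls_induct)
    case base
    then show ?case using hs_wall[OF inc] x comp_self wall_self by auto
  next
    case (step y z)
    then obtain t where t: "y \<in> carrier G" "t \<in> T" "z = y \<otimes> t" by (auto simp: EP_def)
    have zP: "z \<in> P" using cls_step[OF step(1,2)] x(2) by (simp only: comp_def)
    show ?case
    proof (cases "y \<in> c \<and> z \<in> c")
      case True
      then show ?thesis using hs_wall[OF inc] zP by blast
    next
      case False
      then show ?thesis using hs_step[OF inc t(1,2)] t step by blast
    qed
  qed
qed

text \<open>On the wall the two half-spaces are cut out by the disjoint sets \<open>P\<close> and
  \<open>Q\<close>; elsewhere both memberships propagate along the same edges.\<close>

lemma hs_disjoint:
  assumes inc: "incident P c" "incident Q c" and "P \<noteq> Q"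
  shows "hs P c \<inter> hs Q c = {}"
proof -
  have PQ: "\<not> (g \<in> P \<and> g \<in> Q)" for g using incident_eq(1) inc assms(3) by metis
  obtain x where x: "x \<in> bd" "c = wall x" using inc by (auto simp: incident_def)
  then have xc: "x \<in> c" using wall_self by simp
  have "\<not> (g \<in> hs P c \<and> g \<in> hs Q c)" if "g \<in> carrier G" for g
    using bd_carrier[OF x(1)] that
  proof (induction rule: walk_induct)
    case base
    show ?case using hs_wall[OF inc(1) xc] hs_wall[OF inc(2) xc] PQ[of x] by simp
  next
    case (step g t)
    show ?case
    proof (cases "g \<in> c \<and> g \<otimes> t \<in> c")
      case True
      then show ?thesis using hs_wall[OF inc(1)] hs_wall[OF inc(2)] PQ[of "g \<otimes> t"] by simp
    next
      case False
      then show ?thesis using hs_step[OF inc(1) step(1,2)] hs_step[OF inc(2) step(1,2)] step(3) by simp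
    qed
  qed
  then show ?thesis using hs_sub[OF inc(1)] by blast
qed

text \<open>The short paths linking neighbours on \<open>wall x\<close> have no boundary vertex on
  another wall, so they never touch \<open>c\<close>.\<close>

lemma hs_constant_on_wall:
  assumes inc: "incident P c" and x: "x \<in> bd" and "wall x \<noteq> c" and y: "y \<in> wall x"
  shows "y \<in> hs P c \<longleftrightarrow> x \<in> hs P c"
proof (rule constant_on_wall[where h="\<lambda>y. y \<in> hs P c", OF x y])
  fix g t assume g: "g \<in> carrier G" "t \<in> T" "g \<in> bd \<longrightarrow> g \<in> wall x"
  have "g \<notin> c"
  proof
    assume gc: "g \<in> c"
    then have "g \<in> wall x" using g(3) incident_eq(3)[OF inc] by blast
    then show False using incident_eq(2)[OF inc gc] assms(3) wall_eq by blast
  qed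
  then show "(g \<otimes> t \<in> hs P c) = (g \<in> hs P c)" using hs_step[OF inc g(1,2)] by blast
qed

text \<open>Of the four corners cut out by two walls, the one facing away from both is empty. A walk
  changes sides only at vertices of one of the walls, and each wall lies on a single side of the
  other.\<close>

lemma hs_transverse:
  assumes inc: "incident P (wall x)" "incident Q (wall y)" and x: "x \<in> bd" and y: "y \<in> bd"
    and neq: "wall x \<noteq> wall y" and g: "g \<in> carrier G"
  shows "(g \<in> hs P (wall x) \<longleftrightarrow> y \<in> hs P (wall x)) \<or> (g \<in> hs Q (wall y) \<longleftrightarrow> x \<in> hs Q (wall y))"
  using bd_carrier[OF x] g
proof (induction rule: walk_induct)
  case (step g t)
  show ?case
  proof (cases "g \<otimes> t \<in> wall x \<or> g \<otimes> t \<in> wall y")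
    case True
    then show ?thesis
      using hs_constant_on_wall[OF inc(1) y] hs_constant_on_wall[OF inc(2) x] neq by blast
  next
    case False
    then show ?thesis using hs_step[OF inc(1) step(1,2)] hs_step[OF inc(2) step(1,2)] step(3) by blast
  qed
qed blast

text \<open>Both walls border on \<open>P\<close>, so each has a vertex on the \<open>P\<close> side
  of the other; the empty corner is the common complement.\<close>

lemma hs_cover:
  assumes inc: "incident P c" "incident P d" and "c \<noteq> d"
  shows "hs P c \<union> hs P d = carrier G"
proof -
  obtain x where x: "x \<in> bd" "P = comp x" "c = wall x" using inc by (auto simp: incident_def)
  obtain y where y: "y \<in> bd" "P = comp y" "d = wall y" using inc by (auto simp: incident_def)
  have "x \<in> hs P d" "y \<in> hs P c" using hs_comp inc x y comp_self by blast+
  then have "g \<in> hs P c \<or> g \<in> hs P d" if "g \<in> carrier G" for g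
    using hs_transverse[of P x P y g] inc x y assms(3) that by blast
  then show ?thesis using hs_sub inc by blast
qed

text \<open>For different walls, the four alternatives say which of the four corners is the empty
  one.\<close>

lemma hs_nested:
  assumes inc: "incident P c" "incident Q d"
  shows "hs P c \<inter> hs Q d = {} \<or> hs P c \<subseteq> hs Q d \<or> hs Q d \<subseteq> hs P c \<or> hs P c \<union> hs Q d = carrier G"
proof (cases "c = d")
  case True
  then show ?thesis using hs_disjoint[of P c Q] inc by blast
next
  case False
  obtain x where x: "x \<in> bd" "c = wall x" using inc by (auto simp: incident_def)
  obtain y where y: "y \<in> bd" "d = wall y" using inc by (auto simp: incident_def)
  have "(g \<in> hs P c \<longleftrightarrow> y \<in> hs P c) \<or> (g \<in> hs Q d \<longleftrightarrow> x \<in> hs Q d)" if "g \<in> carrier G" for g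
    using hs_transverse[of P x Q y g] inc x y False that by blast
  moreover have "hs P c \<subseteq> carrier G" "hs Q d \<subseteq> carrier G" using hs_sub inc by auto
  ultimately show ?thesis by (cases "y \<in> hs P c"; cases "x \<in> hs Q d") blast+
qed

section \<open>Equivariance of the half-spaces\<close>

lemma incident_translate:
  assumes "h \<in> H" "incident P c" shows "incident ((\<otimes>) h ` P) ((\<otimes>) h ` c)"
proof -
  obtain x where x: "x \<in> bd" "P = comp x" "c = wall x" using assms by (auto simp: incident_def)
  show ?thesis unfolding incident_def x(2,3)
    using comp_translate[OF assms(1) bd_carrier[OF x(1)]] wall_translate[OF assms(1) x(1)]
      bd_translate[OF assms(1) x(1)] by (intro bexI[of _ "h \<otimes> x"]) simp_all
qed

lemma mem_translate_iff:
  assumes "h \<in> carrier G" "g \<in> carrier G" "A \<subseteq> carrier G"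
  shows "h \<otimes> g \<in> (\<otimes>) h ` A \<longleftrightarrow> g \<in> A"
  using assms by (auto simp: subset_iff)

text \<open>\<open>hs\<close> is a choice, so equivariance comes from uniqueness: the translate
  satisfies the characterisation for the translated pair.\<close>

lemma hs_translate:
  assumes h: "h \<in> H" and inc: "incident P c"
  shows "hs ((\<otimes>) h ` P) ((\<otimes>) h ` c) = (\<otimes>) h ` hs P c"
proof -
  obtain x where x: "x \<in> bd" "P = comp x" "c = wall x" using inc by (auto simp: incident_def)
  have hc: "h \<in> carrier G" using h by (rule H_carrier)
  have sub: "P \<subseteq> carrier G" "c \<subseteq> carrier G" "hs P c \<subseteq> carrier G"
    using comp_sub bd_carrier subsetD[OF wall_sub] hs_sub[OF inc] x by auto
  have "is_hs ((\<otimes>) h ` P) ((\<otimes>) h ` c) ((\<otimes>) h ` hs P c)" unfolding is_hs_def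
  proof (intro conjI ballI impI)
    show "(\<otimes>) h ` hs P c \<subseteq> carrier G" using sub hc by auto
  next
    fix g assume "g \<in> (\<otimes>) h ` c"
    then obtain g' where g': "g' \<in> c" "g = h \<otimes> g'" by auto
    then have "g' \<in> carrier G" using sub by auto
    then show "g \<in> (\<otimes>) h ` hs P c \<longleftrightarrow> g \<in> (\<otimes>) h ` P"
      unfolding g'(2) using mem_translate_iff[OF hc] sub hs_wall[OF inc g'(1)] by simp
  next
    fix g t assume g: "g \<in> carrier G" and t: "t \<in> T" and n: "\<not> (g \<in> (\<otimes>) h ` c \<and> g \<otimes> t \<in> (\<otimes>) h ` c)"
    define g' where "g' = inv h \<otimes> g"
    have g': "g' \<in> carrier G" "g = h \<otimes> g'" "g \<otimes> t = h \<otimes> (g' \<otimes> t)" "g' \<otimes> t \<in> carrier G"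
      using g hc T_sub[OF t] by (auto simp: g'_def m_assoc[symmetric])
    then have "\<not> (g' \<in> c \<and> g' \<otimes> t \<in> c)" using n by auto
    then show "g \<otimes> t \<in> (\<otimes>) h ` hs P c \<longleftrightarrow> g \<in> (\<otimes>) h ` hs P c"
      unfolding g'(3) unfolding g'(2) using mem_translate_iff[OF hc] sub g' hs_step[OF inc g'(1) t] by simp
  qed
  moreover have "(\<otimes>) h ` c \<subseteq> carrier G" "h \<otimes> x \<in> (\<otimes>) h ` c" using sub hc x wall_self by auto
  ultimately show ?thesis using hs_unique is_hs_hs[OF incident_translate[OF h inc]] by blast
qed

end

section \<open>Equivariant flows and stabilisers\<close>

lemma funpow_merge_trans:
  fixes N :: "'v \<Rightarrow> 'v"
  assumes "(N ^^ i) u = (N ^^ j) v" "(N ^^ k) v = (N ^^ l) w"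
  shows "\<exists>i j. (N ^^ i) u = (N ^^ j) w"
proof -
  have "(N ^^ (k + i)) u = (N ^^ k) ((N ^^ j) v)" using assms(1) by (simp add: funpow_add)
  also have "\<dots> = (N ^^ j) ((N ^^ k) v)" by (metis add.commute comp_apply funpow_add)
  also have "\<dots> = (N ^^ (j + l)) w" using assms(2) by (simp add: funpow_add)
  finally show ?thesis by blast
qed

context group begin

text \<open>The vertex and the element \<open>t\<close> come from a relation \<open>N\<^sup>p v = t v\<close> with \<open>p > 0\<close> minimal.\<close>

lemma flow_generates:
  fixes act :: "'a \<Rightarrow> 'v \<Rightarrow> 'v"
  assumes K: "subgroup K G"
    and act_closed: "\<And>k v. k \<in> K \<Longrightarrow> v \<in> V \<Longrightarrow> act k v \<in> V"
    and act_one: "\<And>v. v \<in> V \<Longrightarrow> act \<one> v = v"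
    and act_mult: "\<And>k l v. k \<in> K \<Longrightarrow> l \<in> K \<Longrightarrow> v \<in> V \<Longrightarrow> act (k \<otimes> l) v = act k (act l v)"
    and N_closed: "\<And>v. v \<in> V \<Longrightarrow> N v \<in> V"
    and N_act: "\<And>k v. k \<in> K \<Longrightarrow> v \<in> V \<Longrightarrow> N (act k v) = act k (N v)"
    and merge: "\<And>v w. v \<in> V \<Longrightarrow> w \<in> V \<Longrightarrow> \<exists>i j. (N ^^ i) v = (N ^^ j) w"
    and recur: "\<And>v. v \<in> V \<Longrightarrow> \<exists>i j. i < j \<and> (\<exists>k\<in>K. (N ^^ j) v = act k ((N ^^ i) v))"
    and "V \<noteq> {}"
  shows "\<exists>v\<in>V. \<exists>t\<in>K. K = generate G (insert t {k \<in> K. act k v = v})"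
proof -
  have K_carrier: "k \<in> carrier G" if "k \<in> K" for k using that subgroup.subset[OF K] by auto
  have pow_closed: "(N ^^ n) v \<in> V" if "v \<in> V" for n v using that N_closed by (induction n) auto
  have pow_act: "(N ^^ n) (act k v) = act k ((N ^^ n) v)" if "k \<in> K" "v \<in> V" for n k v
    using that N_act pow_closed by (induction n) auto
  define Q where "Q p \<longleftrightarrow> 0 < p \<and> (\<exists>v\<in>V. \<exists>t\<in>K. (N ^^ p) v = act t v)" for p
  obtain v0 where v0: "v0 \<in> V" using assms by auto
  obtain i j k where ij: "i < j" "k \<in> K" "(N ^^ j) v0 = act k ((N ^^ i) v0)" using recur[OF v0] by blast
  have "(N ^^ (j - i)) ((N ^^ i) v0) = (N ^^ j) v0" using ij(1) by (simp flip: funpow_add comp_apply[of "N ^^ (j - i)"])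
  then have "Q (j - i)" using ij pow_closed[OF v0] unfolding Q_def by auto
  then have "Q (LEAST p. Q p)" by (rule LeastI)
  then obtain p v t where p: "p = (LEAST p. Q p)" "0 < p" and v: "v \<in> V" and t: "t \<in> K"
    and vt: "(N ^^ p) v = act t v" unfolding Q_def by auto
  have p_min: "\<not> Q r" if "r < p" for r using that p not_less_Least by auto
  have t_pow: "t [^] a \<in> K" for a :: nat using t K by (induction a) (auto intro: subgroup.m_closed subgroup.one_closed)
  have v_pow: "(N ^^ (p * a)) v = act (t [^] a) v" for a
  proof (induction a)
    case (Suc a)
    have "(N ^^ (p * Suc a)) v = (N ^^ (p * a)) ((N ^^ p) v)" by (simp only: mult_Suc_right add.commute[of p] funpow_add comp_apply)
    also have "\<dots> = act t (act (t [^] a) v)" using pow_act[OF t v] Suc vt by simp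
    also have "\<dots> = act (t [^] Suc a) v"
      using act_mult[OF t t_pow v] t_pow K_carrier[OF t] by (metis nat_pow_Suc nat_pow_Suc2)
    finally show ?case .
  qed (use act_one[OF v] in simp)
  let ?A = "insert t {k \<in> K. act k v = v}"
  have "k \<in> generate G ?A" if k: "k \<in> K" for k
  proof -
    obtain a b where ab: "(N ^^ a) v = (N ^^ b) (act k v)" using merge[OF v act_closed[OF k v]] by blast
    \<comment> \<open>Applying \<open>N\<close> another \<open>y\<close> times turns the exponent
      \<open>a\<close> into the multiple \<open>p * a\<close> of the period, where the flow acts as
      a power of \<open>t\<close>.\<close>
    define y where "y = (p - 1) * a"
    have ya: "p * a = y + a" using p(2) by (cases p) (auto simp: y_def)
    define q where "q = (y + b) div p"
    define r where "r = (y + b) mod p"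
    have yb: "y + b = r + p * q" by (simp add: q_def r_def)
    have rp: "r < p" using p(2) by (simp add: r_def)
    have "act (t [^] a) v = (N ^^ y) ((N ^^ a) v)" using v_pow[of a] by (simp add: ya funpow_add)
    also have "\<dots> = (N ^^ (y + b)) (act k v)" using ab by (simp add: funpow_add)
    also have "\<dots> = act k ((N ^^ r) ((N ^^ (p * q)) v))" unfolding pow_act[OF k v] yb by (simp add: funpow_add)
    also have "\<dots> = act (k \<otimes> t [^] q) ((N ^^ r) v)"
      using v_pow[of q] pow_act[OF t_pow v] act_mult[OF k t_pow pow_closed[OF v]] by simp
    finally have eq: "act (t [^] a) v = act (k \<otimes> t [^] q) ((N ^^ r) v)" .
    have kq: "k \<otimes> t [^] q \<in> K" using k t_pow K by (auto intro: subgroup.m_closed)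
    have ikq: "inv (k \<otimes> t [^] q) \<in> K" using kq K by (auto intro: subgroup.m_inv_closed)
    have "act (inv (k \<otimes> t [^] q)) (act (t [^] a) v) = (N ^^ r) v"
      unfolding eq using act_mult[OF ikq kq pow_closed[OF v], symmetric] act_one[OF pow_closed[OF v]] K_carrier[OF kq] by simp
    then have nr: "(N ^^ r) v = act (inv (k \<otimes> t [^] q) \<otimes> t [^] a) v" using act_mult[OF ikq t_pow v] by simp
    have "inv (k \<otimes> t [^] q) \<otimes> t [^] a \<in> K" using ikq t_pow K by (auto intro: subgroup.m_closed)
    \<comment> \<open>A nonzero remainder would be a smaller period, against the minimality of
      \<open>p\<close>.\<close>
    then have "0 < r \<longrightarrow> Q r" using nr v unfolding Q_def by metis
    then have "r = 0" using p_min[OF rp] by blast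
    \<comment> \<open>What remains of \<open>k\<close> after removing powers of \<open>t\<close> on
      both sides fixes \<open>v\<close>.\<close>
    define s where "s = inv (t [^] a) \<otimes> (k \<otimes> t [^] q)"
    have ita: "inv (t [^] a) \<in> K" using t_pow K by (auto intro: subgroup.m_inv_closed)
    have s: "s \<in> K" using ita kq K by (auto simp: s_def intro: subgroup.m_closed)
    have "act s v = act (inv (t [^] a)) (act (t [^] a) v)"
      unfolding s_def using act_mult[OF ita kq v] eq \<open>r = 0\<close> by simp
    also have "\<dots> = v" using act_mult[OF ita t_pow v, symmetric] act_one[OF v] K_carrier[OF t_pow] by simp
    finally have sA: "s \<in> generate G ?A" using s by (intro generate.incl) auto
    have tA: "t [^] n \<in> generate G ?A" for n :: nat
      by (induction n) (auto intro: generate.one generate.eng generate.incl)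
    have gA: "?A \<subseteq> carrier G" using K_carrier t by auto
    have "k = t [^] a \<otimes> s \<otimes> inv (t [^] q)"
      unfolding s_def using K_carrier[OF k] K_carrier[OF t] by (simp add: m_assoc) (simp add: m_assoc[symmetric])
    then show ?thesis
      using tA sA generate_m_inv_closed[OF gA tA] by (metis generate.eng)
  qed
  moreover have "generate G ?A \<subseteq> K" using t by (intro generate_subgroup_incl[OF _ K]) auto
  ultimately show ?thesis using v t by blast
qed

text \<open>A Schreier-type argument: \<open>q\<close> picks one representative in \<open>v\<close>
  for each coset of \<open>K\<close> that meets \<open>v\<close>, and \<open>\<rho>\<close> is the
  factor in \<open>K\<close>. Each edge of the connected set \<open>v\<close> can be moved by
  \<open>K\<close> to start at a representative, so there is at most one generator for each
  representative and each element of \<open>D\<close>.\<close>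

lemma stabiliser_generated:
  assumes K: "subgroup K G" and v: "v \<subseteq> carrier G" "v = cls E x0"
    and D: "finite D" "D \<subseteq> carrier G" and E: "\<And>x y. (x, y) \<in> E \<Longrightarrow> x \<in> v \<Longrightarrow> \<exists>b\<in>D. y = x \<otimes> b"
    and block: "\<And>k x. k \<in> K \<Longrightarrow> x \<in> v \<Longrightarrow> k \<otimes> x \<in> v \<Longrightarrow> (\<otimes>) k ` v = v"
    and fin: "finite ((\<lambda>x. K #> x) ` v)"
  shows "\<exists>A. finite A \<and> A \<subseteq> K \<and> card A \<le> card ((\<lambda>x. K #> x) ` v) * card D \<and>
    {k \<in> K. (\<otimes>) k ` v = v} \<subseteq> generate G A"
proof -
  have K_carrier: "k \<in> carrier G" if "k \<in> K" for k using that subgroup.subset[OF K] by auto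
  have v_carrier: "x \<in> carrier G" if "x \<in> v" for x using that v by auto
  have coset_self: "x \<in> K #> x" if "x \<in> carrier G" for x
    using that subgroup.rcos_module_imp rcos_self[OF that K] by simp
  define q where "q x = (SOME y. y \<in> v \<and> K #> y = K #> x)" for x
  have q: "q x \<in> v" "K #> q x = K #> x" if "x \<in> v" for x
  proof -
    have "\<exists>y. y \<in> v \<and> K #> y = K #> x" using that by blast
    from someI_ex[OF this] show "q x \<in> v" "K #> q x = K #> x" unfolding q_def by auto
  qed
  have q_cong: "q x = q y" if "K #> x = K #> y" for x y using that by (simp add: q_def)
  define \<rho> where "\<rho> x = x \<otimes> inv (q x)" for x
  have \<rho>: "\<rho> x \<in> K" "x = \<rho> x \<otimes> q x" if "x \<in> v" for x
  proof -
    have "x \<in> K #> q x" using coset_self[OF v_carrier[OF that]] q(2)[OF that] by simp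
    then obtain k where k: "k \<in> K" "x = k \<otimes> q x" by (auto simp: r_coset_def)
    have qc: "q x \<in> carrier G" using v_carrier q(1)[OF that] by blast
    have "\<rho> x = k" unfolding \<rho>_def by (subst k(2)) (use qc K_carrier[OF k(1)] in \<open>simp add: m_assoc\<close>)
    then show "\<rho> x \<in> K" "x = \<rho> x \<otimes> q x" using k by auto
  qed
  define A where "A = (\<lambda>(y, b). \<rho> (y \<otimes> b)) ` {(y, b) \<in> (q ` v) \<times> D. y \<otimes> b \<in> v}"
  have card_q: "finite (q ` v)" "card (q ` v) \<le> card ((\<lambda>x. K #> x) ` v)"
  proof -
    have "q ` v = (\<lambda>C. SOME y. y \<in> v \<and> K #> y = C) ` (\<lambda>x. K #> x) ` v"
      by (simp add: image_image q_def)
    then show "finite (q ` v)" "card (q ` v) \<le> card ((\<lambda>x. K #> x) ` v)"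
      using fin by (simp_all add: card_image_le)
  qed
  have fA: "finite {(y, b) \<in> (q ` v) \<times> D. y \<otimes> b \<in> v}"
    by (rule finite_subset[of _ "(q ` v) \<times> D"]) (use card_q D in auto)
  have "card A \<le> card {(y, b) \<in> (q ` v) \<times> D. y \<otimes> b \<in> v}" unfolding A_def by (rule card_image_le[OF fA])
  also have "\<dots> \<le> card ((q ` v) \<times> D)" using card_q D by (intro card_mono) auto
  also have "\<dots> = card (q ` v) * card D" by (rule card_cartesian_product)
  also have "\<dots> \<le> card ((\<lambda>x. K #> x) ` v) * card D" using card_q by simp
  finally have card_A: "card A \<le> card ((\<lambda>x. K #> x) ` v) * card D" .
  have AK: "A \<subseteq> K" using \<rho> by (auto simp: A_def)
  have gen_sub: "generate G A \<subseteq> K" using AK by (intro generate_subgroup_incl[OF _ K])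
  define y0 where "y0 = q x0"
  have x0: "x0 \<in> v" using v cls_self by metis
  \<comment> \<open>The base point \<open>x0\<close> need not be a representative, so the products
    are normalised by \<open>\<rho> x0\<close>.\<close>
  have \<rho>_gen: "inv (\<rho> x0) \<otimes> \<rho> x \<in> generate G A" if "x \<in> v" for x
  proof -
    have "x \<in> cls E x0" using that v by simp
    then show ?thesis
    proof (induction rule: cls_induct)
      case base
      then show ?case using K_carrier[OF \<rho>(1)[OF x0]] generate.one by simp
    next
      case (step x z)
      have xv: "x \<in> v" and zv: "z \<in> v" using step v cls_step by metis+
      obtain b where b: "b \<in> D" "z = x \<otimes> b" using E[OF step(2) xv] by blast
      have bc: "b \<in> carrier G" using b D by auto
      have qc: "q x \<in> carrier G" using q(1)[OF xv] v_carrier by blast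
      have \<rho>c: "\<rho> x \<in> carrier G" using K_carrier \<rho>(1)[OF xv] by blast
      \<comment> \<open>Undoing \<open>\<rho> x\<close> moves \<open>x\<close> to its representative
        inside \<open>v\<close>, so by \<open>block\<close> the far end of the edge stays in
        \<open>v\<close> as well.\<close>
      have "(\<otimes>) (inv (\<rho> x)) ` v = v"
      proof (rule block[OF _ xv])
        show "inv (\<rho> x) \<in> K" using \<rho>(1)[OF xv] K by (auto intro: subgroup.m_inv_closed)
        have "inv (\<rho> x) \<otimes> x = q x" using \<rho>(2)[OF xv] \<rho>c qc by (metis inv_closed l_inv l_one m_assoc)
        then show "inv (\<rho> x) \<otimes> x \<in> v" using q(1)[OF xv] by simp
      qed
      then have "inv (\<rho> x) \<otimes> z \<in> v" using zv by blast
      moreover have "inv (\<rho> x) \<otimes> z = q x \<otimes> b"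
        using \<rho>(2)[OF xv] \<rho>c qc bc b(2) by (metis inv_closed l_inv l_one m_assoc m_closed)
      ultimately have qb: "q x \<otimes> b \<in> v" by simp
      then have "\<rho> (q x \<otimes> b) \<in> A" unfolding A_def using b(1) xv by (intro image_eqI[of _ _ "(q x, b)"]) auto
      moreover have "\<rho> z = \<rho> x \<otimes> \<rho> (q x \<otimes> b)"
      proof -
        have z_eq: "z = \<rho> x \<otimes> (q x \<otimes> b)" using \<rho>(2)[OF xv] \<rho>c qc bc b(2) by (metis m_assoc)
        have "K #> z = (K #> \<rho> x) #> (q x \<otimes> b)"
          using z_eq \<rho>c qc bc subgroup.subset[OF K] by (simp add: coset_mult_assoc)
        also have "K #> \<rho> x = K" using coset_join2[OF \<rho>c K \<rho>(1)[OF xv]] .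
        finally have qz: "q z = q (q x \<otimes> b)" by (rule q_cong)
        have "q (q x \<otimes> b) \<in> carrier G" using q(1)[OF qb] v_carrier by blast
        then have "\<rho> x \<otimes> (q x \<otimes> b) \<otimes> inv (q (q x \<otimes> b)) = \<rho> x \<otimes> \<rho> (q x \<otimes> b)"
          using \<rho>c qc bc unfolding \<rho>_def[of "q x \<otimes> b"] by (simp add: m_assoc)
        then show ?thesis using qz z_eq unfolding \<rho>_def[of z] by metis
      qed
      moreover have "inv (\<rho> x0) \<otimes> (\<rho> x \<otimes> \<rho> (q x \<otimes> b)) = inv (\<rho> x0) \<otimes> \<rho> x \<otimes> \<rho> (q x \<otimes> b)"
        using K_carrier \<rho>(1) x0 xv qb by (simp add: m_assoc)
      ultimately show ?case using step(3) by (simp add: generate.eng generate.incl)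
    qed
  qed
  \<comment> \<open>Comparing the values of \<open>\<rho>\<close> at \<open>k \<otimes> q x0\<close>
    and at \<open>q x0\<close>, which are \<open>k\<close> and one, removes the factor
    \<open>\<rho> x0\<close>.\<close>
  have "k \<in> generate G A" if k: "k \<in> K" "(\<otimes>) k ` v = v" for k
  proof -
    have kc: "k \<in> carrier G" using K_carrier k by blast
    have x0c: "x0 \<in> carrier G" "q x0 \<in> carrier G" using v_carrier x0 q(1) by blast+
    have kv: "k \<otimes> q x0 \<in> v" using k q(1)[OF x0] by blast
    have qq: "q (q x0) = q x0" using q_cong q(2)[OF x0] by blast
    have "K #> (k \<otimes> q x0) = (K #> k) #> q x0"
      using kc x0c subgroup.subset[OF K] by (simp add: coset_mult_assoc)
    also have "K #> k = K" using coset_join2[OF kc K k(1)] .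
    finally have "q (k \<otimes> q x0) = q x0" using q_cong qq by metis
    then have 1: "\<rho> (k \<otimes> q x0) = k" using kc x0c by (simp add: \<rho>_def m_assoc)
    have 2: "\<rho> (q x0) = \<one>" using qq x0c by (simp add: \<rho>_def)
    have \<rho>0: "\<rho> x0 \<in> carrier G" using K_carrier \<rho>(1)[OF x0] by blast
    have "inv (\<rho> x0) \<otimes> k \<in> generate G A" using \<rho>_gen[OF kv] 1 by simp
    moreover have "inv (\<rho> x0) \<in> generate G A" using \<rho>_gen[OF q(1)[OF x0]] 2 \<rho>0 by simp
    then have "inv (inv (\<rho> x0)) \<in> generate G A"
      using AK K_carrier by (intro generate_m_inv_closed[OF _ \<open>inv (\<rho> x0) \<in> generate G A\<close>]) auto
    ultimately have "\<rho> x0 \<otimes> (inv (\<rho> x0) \<otimes> k) \<in> generate G A" using \<rho>0 by (simp add: generate.eng)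
    then show ?thesis using \<rho>0 kc by (simp add: m_assoc[symmetric])
  qed
  moreover have "finite A" unfolding A_def using fA by simp
  ultimately show ?thesis using card_A AK by blast
qed

end

section \<open>Orienting the tree\<close>

lemma (in group) translate_mult:
  assumes "k \<in> carrier G" "l \<in> carrier G" "A \<subseteq> carrier G"
  shows "(\<otimes>) (k \<otimes> l) ` A = (\<otimes>) k ` (\<otimes>) l ` A"
  unfolding image_image using assms by (intro image_cong HOL.refl m_assoc) auto

lemma (in group) translate_one: "A \<subseteq> carrier G \<Longrightarrow> (\<otimes>) \<one> ` A = A"
  by (force simp: subset_iff)

text \<open>Components of colour classes and walls are the vertices of a tree, and incident pairs are its
  edges. The predicate \<open>big\<close> orients every edge; the vertices are tagged with \<^const>\<open>True\<close> for
  components and \<^const>\<open>False\<close> for walls.\<close>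

locale oriented = coloured +
  fixes K :: "'a set" and big :: "'a set \<Rightarrow> bool"
  assumes K_sub: "subgroup K G" and K_H: "K \<subseteq> H" and fin_K: "finite (rcosets K)"
    and big_disjoint: "incident P c \<Longrightarrow> incident Q c \<Longrightarrow> P \<noteq> Q \<Longrightarrow> \<not> (big (hs P c) \<and> big (hs Q c))"
    and big_cover: "incident P c \<Longrightarrow> incident P d \<Longrightarrow> c \<noteq> d \<Longrightarrow> big (hs P c) \<or> big (hs P d)"
    and big_act: "k \<in> K \<Longrightarrow> incident P c \<Longrightarrow> big ((\<otimes>) k ` hs P c) \<longleftrightarrow> big (hs P c)"
begin

definition verts :: "('a set \<times> bool) set" where
  "verts = (\<lambda>g. (comp g, True)) ` carrier G \<union> (\<lambda>g. (wall g, False)) ` bd"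

definition act :: "'a \<Rightarrow> 'a set \<times> bool \<Rightarrow> 'a set \<times> bool" where
  "act k v = ((\<otimes>) k ` fst v, snd v)"

text \<open>\<open>hs P c\<close> is the branch on the side of \<open>P\<close>, so an arrow always
  points into the branch chosen as the larger one.\<close>

definition arrow :: "'a set \<times> bool \<Rightarrow> 'a set \<times> bool \<Rightarrow> bool" where
  "arrow v w \<longleftrightarrow> (\<exists>P c. incident P c \<and>
    (v = (P, True) \<and> w = (c, False) \<and> \<not> big (hs P c) \<or> v = (c, False) \<and> w = (P, True) \<and> big (hs P c)))"

text \<open>A vertex without an outgoing arrow stays put. This makes the flow total and treats the
  case of a sink together with that of an endless flow.\<close>

definition nxt :: "'a set \<times> bool \<Rightarrow> 'a set \<times> bool" where
  "nxt v = (if \<exists>w. arrow v w then SOME w. arrow v w else v)"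

lemma K_carrier: "k \<in> K \<Longrightarrow> k \<in> carrier G" using subgroup.subset[OF K_sub] by auto

lemma verts_sub: "v \<in> verts \<Longrightarrow> fst v \<subseteq> carrier G"
  using subsetD[OF comp_sub] subsetD[OF wall_sub] bd_carrier by (auto simp: verts_def)

text \<open>At a component two outgoing arrows contradict \<open>big_cover\<close>; at a wall they
  contradict \<open>big_disjoint\<close>.\<close>

lemma arrow_unique:
  assumes "arrow v w" "arrow v w'" shows "w = w'"
proof (cases "snd v")
  case True
  then obtain P c where 1: "incident P c" "v = (P, True)" "w = (c, False)" "\<not> big (hs P c)"
    using assms(1) by (auto simp: arrow_def)
  with True obtain d where 2: "incident P d" "w' = (d, False)" "\<not> big (hs P d)"
    using assms(2) by (auto simp: arrow_def)
  show ?thesis using big_cover[OF 1(1) 2(1)] 1 2 by blast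
next
  case False
  then obtain P c where 1: "incident P c" "v = (c, False)" "w = (P, True)" "big (hs P c)"
    using assms(1) by (auto simp: arrow_def)
  with False obtain Q where 2: "incident Q c" "w' = (Q, True)" "big (hs Q c)"
    using assms(2) by (auto simp: arrow_def)
  show ?thesis using big_disjoint[OF 1(1) 2(1)] 1 2 by blast
qed

lemma nxt_arrow: "arrow v w \<Longrightarrow> nxt v = w"
  unfolding nxt_def using arrow_unique some_equality[of "arrow v" w] by metis

lemma nxt_stay: "(\<And>w. \<not> arrow v w) \<Longrightarrow> nxt v = v"
  by (simp add: nxt_def)

lemma incident_verts: "incident P c \<Longrightarrow> (P, True) \<in> verts \<and> (c, False) \<in> verts"
  using bd_carrier by (auto simp: incident_def verts_def)

lemma arrow_verts: "arrow v w \<Longrightarrow> v \<in> verts \<and> w \<in> verts"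
  using incident_verts by (auto simp: arrow_def)

lemma nxt_verts: "v \<in> verts \<Longrightarrow> nxt v \<in> verts"
  using arrow_verts nxt_arrow nxt_stay by metis

lemma act_verts:
  assumes k: "k \<in> K" and v: "v \<in> verts" shows "act k v \<in> verts"
proof -
  have kH: "k \<in> H" using k K_H by auto
  consider g where "g \<in> carrier G" "v = (comp g, True)" | g where "g \<in> bd" "v = (wall g, False)"
    using v by (auto simp: verts_def)
  then show ?thesis
  proof cases
    case 1
    then have "act k v = (comp (k \<otimes> g), True)" "k \<otimes> g \<in> carrier G"
      using comp_translate[OF kH] K_carrier[OF k] by (auto simp: act_def)
    then show ?thesis by (auto simp: verts_def)
  next
    case 2
    then have "act k v = (wall (k \<otimes> g), False)" "k \<otimes> g \<in> bd"
      using wall_translate[OF kH] bd_translate[OF kH] by (auto simp: act_def)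
    then show ?thesis by (auto simp: verts_def)
  qed
qed

lemma act_one: "v \<in> verts \<Longrightarrow> act \<one> v = v"
  using verts_sub by (simp add: act_def translate_one)

lemma act_mult: "k \<in> K \<Longrightarrow> l \<in> K \<Longrightarrow> v \<in> verts \<Longrightarrow> act (k \<otimes> l) v = act k (act l v)"
  using verts_sub K_carrier by (simp add: act_def translate_mult)

lemma arrow_act:
  assumes k: "k \<in> K" and "arrow v w" shows "arrow (act k v) (act k w)"
proof -
  have kH: "k \<in> H" using k K_H by auto
  obtain P c where inc: "incident P c" and
    vw: "v = (P, True) \<and> w = (c, False) \<and> \<not> big (hs P c) \<or> v = (c, False) \<and> w = (P, True) \<and> big (hs P c)"
    using assms(2) by (auto simp: arrow_def)
  have "big (hs ((\<otimes>) k ` P) ((\<otimes>) k ` c)) \<longleftrightarrow> big (hs P c)"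
    using hs_translate[OF kH inc] big_act[OF k inc] by simp
  moreover have "act k v = ((\<otimes>) k ` P, True) \<and> act k w = ((\<otimes>) k ` c, False) \<and> \<not> big (hs P c) \<or>
      act k v = ((\<otimes>) k ` c, False) \<and> act k w = ((\<otimes>) k ` P, True) \<and> big (hs P c)"
    using vw by (elim disjE conjE) (simp_all add: act_def)
  ultimately show ?thesis using incident_translate[OF kH inc] unfolding arrow_def by metis
qed

lemma nxt_act:
  assumes k: "k \<in> K" and v: "v \<in> verts" shows "nxt (act k v) = act k (nxt v)"
proof (cases "\<exists>w. arrow v w")
  case True
  then obtain w where "arrow v w" by blast
  then show ?thesis using nxt_arrow arrow_act[OF k] by metis
next
  case False
  have "\<not> arrow (act k v) w" for w
  proof
    assume "arrow (act k v) w"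
    moreover have ik: "inv k \<in> K" using k K_sub by (auto intro: subgroup.m_inv_closed)
    ultimately have "arrow (act (inv k) (act k v)) (act (inv k) w)" by (intro arrow_act)
    moreover have "act (inv k) (act k v) = v"
      using act_mult[OF ik k v, symmetric] act_one[OF v] K_carrier[OF k] by simp
    ultimately show False using False by metis
  qed
  then show ?thesis using nxt_stay False by metis
qed

definition merges :: "'a set \<times> bool \<Rightarrow> 'a set \<times> bool \<Rightarrow> bool" where
  "merges v w \<longleftrightarrow> (\<exists>i j. (nxt ^^ i) v = (nxt ^^ j) w)"

lemma merges_self: "merges v v" unfolding merges_def by blast

lemma merges_sym: "merges v w \<Longrightarrow> merges w v" unfolding merges_def by metis

lemma merges_trans: "merges u v \<Longrightarrow> merges v w \<Longrightarrow> merges u w"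
  unfolding merges_def using funpow_merge_trans[where N=nxt] by blast

text \<open>Every edge is oriented one way or the other, so the flow carries one of its ends to the
  other.\<close>

lemma incident_merges:
  assumes "incident P c" shows "merges (P, True) (c, False)"
proof (cases "big (hs P c)")
  case True
  then have "arrow (c, False) (P, True)" using assms by (auto simp: arrow_def)
  then have "(nxt ^^ 0) (P, True) = (nxt ^^ 1) (c, False)" by (simp add: nxt_arrow)
  then show ?thesis unfolding merges_def by blast
next
  case False
  then have "arrow (P, True) (c, False)" using assms by (auto simp: arrow_def)
  then have "(nxt ^^ 1) (P, True) = (nxt ^^ 0) (c, False)" by (simp add: nxt_arrow)
  then show ?thesis unfolding merges_def by blast
qed

lemma comp_merges:
  assumes "g0 \<in> carrier G" "g \<in> carrier G" shows "merges (comp g0, True) (comp g, True)"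
  using assms
proof (induction rule: walk_induct)
  case base
  show ?case by (rule merges_self)
next
  case (step g t)
  show ?case
  proof (cases "comp (g \<otimes> t) = comp g")
    case True
    then show ?thesis using step by simp
  next
    case False
    note bd = bd_step[OF step(1,2) False]
    have "incident (comp g) (wall g)" using bd by (auto simp: incident_def)
    moreover have "incident (comp (g \<otimes> t)) (wall g)" using bd wall_eq[OF bd(3)] unfolding incident_def by metis
    ultimately have "merges (comp g, True) (comp (g \<otimes> t), True)"
      using incident_merges merges_sym merges_trans by meson
    then show ?thesis using step(3) merges_trans by blast
  qed
qed

lemma verts_merge:
  assumes "v \<in> verts" "w \<in> verts" shows "merges v w"
proof -
  have "merges (comp \<one>, True) u" if u: "u \<in> verts" for u
  proof -
    consider g where "g \<in> carrier G" "u = (comp g, True)" | g where "g \<in> bd" "u = (wall g, False)"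
      using u by (auto simp: verts_def)
    then show ?thesis
    proof cases
      case 1
      then show ?thesis using comp_merges by simp
    next
      case 2
      then have "incident (comp g) (wall g)" by (auto simp: incident_def)
      then show ?thesis using incident_merges merges_trans comp_merges[OF one_closed bd_carrier[OF 2(1)]] 2(2)
        by blast
    qed
  qed
  then show ?thesis using assms merges_sym merges_trans by blast
qed

text \<open>Vertices of one type are equivalence classes permuted by \<open>K\<close>, so a
  translate sharing a point with a class is that class.\<close>

lemma same_orbit:
  assumes v: "v \<in> verts" "w \<in> verts" "snd v = snd w" and x: "x \<in> fst v" "y \<in> fst w" and k: "k \<in> K" "y = k \<otimes> x"
  shows "w = act k v"
proof -
  have kH: "k \<in> H" using k K_H by auto
  show ?thesis
  proof (cases "snd v")
    case True
    then obtain g g' where g: "g \<in> carrier G" "v = (comp g, True)" "w = (comp g', True)"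
      using v by (auto simp: verts_def)
    then have eq: "comp g = comp x" "comp g' = comp y" using x comp_eq by auto
    have "x \<in> carrier G" using g x comp_sub by auto
    from comp_translate[OF kH this] show ?thesis using g eq k(2) by (simp add: act_def)
  next
    case False
    then obtain g g' where g: "g \<in> bd" "v = (wall g, False)" "w = (wall g', False)"
      using v by (auto simp: verts_def)
    then have eq: "wall g = wall x" "wall g' = wall y" using x wall_eq by auto
    have "x \<in> bd" using g x subsetD[OF wall_sub] by auto
    from wall_translate[OF kH this] show ?thesis using g eq k(2) by (simp add: act_def)
  qed
qed

text \<open>Pigeonhole: a flow line is infinite, but a chosen point on each vertex has only finitely
  many cosets of \<open>K\<close> and two types available.\<close>

lemma verts_recur:
  assumes v: "v \<in> verts"
  shows "\<exists>i j. i < j \<and> (\<exists>k\<in>K. (nxt ^^ j) v = act k ((nxt ^^ i) v))"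
proof -
  define u where "u i = (nxt ^^ i) v" for i
  have u: "u i \<in> verts" for i unfolding u_def using v nxt_verts by (induction i) auto
  define pt where "pt i = (SOME x. x \<in> fst (u i))" for i
  have pt: "pt i \<in> fst (u i)" "pt i \<in> carrier G" for i
  proof -
    have "\<exists>x. x \<in> fst (u i)" using u[of i] comp_self wall_self unfolding verts_def by force
    then show "pt i \<in> fst (u i)" unfolding pt_def by (rule someI_ex)
    then show "pt i \<in> carrier G" using verts_sub[OF u] by blast
  qed
  define F where "F i = (K #> pt i, snd (u i))" for i
  have "range F \<subseteq> (rcosets K) \<times> UNIV" using pt by (auto simp: F_def RCOSETS_def)
  then have "finite (range F)" using fin_K by (meson finite_SigmaI finite_code finite_subset)
  then have "\<not> inj F" using finite_imageD infinite_UNIV_nat by blast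
  then obtain i j where "F i = F j" "i \<noteq> j" by (auto simp: inj_def)
  then obtain i j where ij: "F i = F j" "i < j" by (metis nat_neq_iff)
  have "pt j \<in> K #> pt i" using ij rcos_self[OF pt(2) K_sub, of j] by (simp add: F_def)
  then obtain k where k: "k \<in> K" "pt j = k \<otimes> pt i" by (auto simp: r_coset_def)
  have "u j = act k (u i)" using ij by (intro same_orbit[OF u u _ pt(1) pt(1) k]) (simp add: F_def)
  then show ?thesis using ij k unfolding u_def by blast
qed

text \<open>\<open>B\<close> serves as step set for components and walls alike. A single wall is
  estimated by the whole boundary, and \<open>Suc\<close> accounts for the element \<open>t\<close>
  along the flow.\<close>

lemma few_generators:
  assumes comps: "\<And>g. g \<in> carrier G \<Longrightarrow> card ((\<lambda>x. K #> x) ` comp g) \<le> M"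
    and walls: "card ((\<lambda>x. K #> x) ` bd) \<le> M"
  shows "\<exists>A. finite A \<and> A \<subseteq> K \<and> card A \<le> Suc (M * card B) \<and> generate G A = K"
proof -
  have "verts \<noteq> {}" by (auto simp: verts_def)
  from flow_generates[OF K_sub act_verts act_one act_mult nxt_verts nxt_act verts_merge[unfolded merges_def] verts_recur this]
  obtain v t where v: "v \<in> verts" and t: "t \<in> K" and K_gen: "K = generate G (insert t {k \<in> K. act k v = v})"
    by blast
  have stab: "{k \<in> K. act k v = v} = {k \<in> K. (\<otimes>) k ` fst v = fst v}"
    by (auto simp: act_def prod_eq_iff)
  have fin: "finite ((\<lambda>x. K #> x) ` A)" if "A \<subseteq> carrier G" for A
    using that by (intro finite_subset[OF _ fin_K]) (auto simp: RCOSETS_def)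
  have block: "(\<otimes>) k ` fst v = fst v" if k: "k \<in> K" and x: "x \<in> fst v" "k \<otimes> x \<in> fst v" for k x
    using same_orbit[OF v v HOL.refl x k HOL.refl] by (simp add: act_def prod_eq_iff)
  have BD: "finite B" "B \<subseteq> carrier G" using fin_B B_sub by auto
  have "\<exists>A. finite A \<and> A \<subseteq> K \<and> card A \<le> card ((\<lambda>x. K #> x) ` fst v) * card B \<and>
    {k \<in> K. (\<otimes>) k ` fst v = fst v} \<subseteq> generate G A"
  proof -
    consider g where "g \<in> carrier G" "v = (comp g, True)" | g where "g \<in> bd" "v = (wall g, False)"
      using v by (auto simp: verts_def)
    then show ?thesis
    proof cases
      case 1
      show ?thesis
      proof (rule stabiliser_generated[OF K_sub verts_sub[OF v] _ BD _ block fin[OF verts_sub[OF v]]])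
        show "fst v = cls EP g" using 1 by (simp add: comp_def)
        show "\<exists>b\<in>B. y = x \<otimes> b" if "(x, y) \<in> EP" for x y using that T_B by (auto simp: EP_def)
      qed
    next
      case 2
      show ?thesis
      proof (rule stabiliser_generated[OF K_sub verts_sub[OF v] _ BD _ block fin[OF verts_sub[OF v]]])
        show "fst v = cls EC g" using 2 by (simp add: wall_def)
        show "\<exists>b\<in>B. y = x \<otimes> b" if "(x, y) \<in> EC" for x y using that by (auto simp: EC_def)
      qed
    qed
  qed
  then obtain A where A: "finite A" "A \<subseteq> K" "card A \<le> card ((\<lambda>x. K #> x) ` fst v) * card B"
    "{k \<in> K. (\<otimes>) k ` fst v = fst v} \<subseteq> generate G A" by blast
  have "card ((\<lambda>x. K #> x) ` fst v) \<le> M"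
  proof -
    consider g where "g \<in> carrier G" "v = (comp g, True)" | g where "g \<in> bd" "v = (wall g, False)"
      using v by (auto simp: verts_def)
    then show ?thesis
    proof cases
      case 1
      then show ?thesis using comps by simp
    next
      case 2
      have "card ((\<lambda>x. K #> x) ` wall g) \<le> card ((\<lambda>x. K #> x) ` bd)"
        using wall_sub[OF 2(1)] bd_carrier by (intro card_mono fin image_mono) auto
      then show ?thesis using 2 walls by simp
    qed
  qed
  then have "card ((\<lambda>x. K #> x) ` fst v) * card B \<le> M * card B" by (rule mult_le_mono1)
  then have "card A \<le> M * card B" using A(3) by linarith
  then have "card (insert t A) \<le> Suc (M * card B)" using A(1) by (simp add: card_insert_if)
  moreover have "generate G (insert t A) = K"
  proof
    show sub: "generate G (insert t A) \<subseteq> K" using A t by (intro generate_subgroup_incl[OF _ K_sub]) auto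
    have tA: "insert t A \<subseteq> carrier G" using A t K_carrier by auto
    have "insert t {k \<in> K. act k v = v} \<subseteq> generate G (insert t A)"
      unfolding stab using A(4) mono_generate[of A "insert t A"] generate.incl[of t "insert t A" G] by auto
    then show "K \<subseteq> generate G (insert t A)"
      using generate_subgroup_incl[OF _ generate_is_subgroup[OF tA]] K_gen by metis
  qed
  ultimately show ?thesis using A t by (intro exI[of _ "insert t A"]) auto
qed

end

section \<open>Orientations from an invariant mean\<close>

context mean_group begin

lemma mean_image_Int:
  assumes "h \<in> carrier G" "A \<subseteq> carrier G" "A' \<subseteq> carrier G"
  shows "\<mu> ((\<otimes>) h ` A \<inter> (\<otimes>) h ` A') = \<mu> (A \<inter> A')"
proof -
  have "inj_on ((\<otimes>) h) (carrier G)" using assms(1) by (auto simp: inj_on_def)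
  then have "(\<otimes>) h ` A \<inter> (\<otimes>) h ` A' = (\<otimes>) h ` (A \<inter> A')" using assms(2,3) by (metis inj_on_image_Int)
  then show ?thesis using assms by (simp add: mean_inv le_infI1)
qed

lemma mean_Un: "A \<subseteq> carrier G \<Longrightarrow> B \<subseteq> carrier G \<Longrightarrow> \<mu> (A \<union> B) = \<mu> A + \<mu> B - \<mu> (A \<inter> B)"
  using mean_split[of "A \<union> B" A] mean_split[of B A] by (simp add: Int_absorb1 Un_Diff Int_commute)

lemma mean_Un_le: "A \<subseteq> carrier G \<Longrightarrow> B \<subseteq> carrier G \<Longrightarrow> \<mu> (A \<union> B) \<le> \<mu> A + \<mu> B"
  using mean_Un[of A B] mean_nonneg[of "A \<inter> B"] by auto

lemma mean_le_1: "A \<subseteq> carrier G \<Longrightarrow> \<mu> A \<le> 1"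
  using mean_mono[of A "carrier G"] mean_one by simp

text \<open>For sets of mean one half, meeting in mean one half is equality up to null sets, hence
  transitive.\<close>

lemma half_trans:
  assumes "A \<subseteq> carrier G" "B \<subseteq> carrier G" "D \<subseteq> carrier G"
    and "\<mu> A = 1/2" "\<mu> B = 1/2" "\<mu> (A \<inter> B) = 1/2" "\<mu> (B \<inter> D) = 1/2"
  shows "\<mu> (A \<inter> D) = 1/2"
proof -
  have "\<mu> (A - B) = 0" "\<mu> (B - D) = 0" using mean_split[of A B] mean_split[of B D] assms by auto
  moreover have "\<mu> (A - D) \<le> \<mu> ((A - B) \<union> (B - D))" using assms by (intro mean_mono) auto
  moreover have "\<mu> ((A - B) \<union> (B - D)) = \<mu> (A - B) + \<mu> (B - D)"
    using assms by (intro mean_add) auto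
  moreover have "0 \<le> \<mu> (A - D)" using assms by (intro mean_nonneg) auto
  ultimately show ?thesis using mean_split[of A D] assms by auto
qed

text \<open>Up to null sets \<open>A\<close> and \<open>D\<close> are both the complement of
  \<open>B\<close>.\<close>

lemma half_complement:
  assumes "A \<subseteq> carrier G" "B \<subseteq> carrier G" "D \<subseteq> carrier G"
    and "\<mu> A = 1/2" "\<mu> B = 1/2" "\<mu> D = 1/2" "\<mu> (A \<inter> B) = 0" "\<mu> (B \<inter> D) = 0"
  shows "\<mu> (A \<inter> D) = 1/2"
proof -
  have "\<mu> (A - B) = 1/2" using mean_split[of A B] assms by auto
  moreover have "\<mu> (D - B) = 1/2" using mean_split[of D B] assms by (auto simp: Int_commute)
  moreover have "\<mu> ((A - B) \<union> (D - B)) \<le> \<mu> (carrier G - B)" using assms by (intro mean_mono) auto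
  moreover have "\<mu> (carrier G - B) = 1/2" using mean_split[of "carrier G" B] assms mean_one by (simp add: Int_absorb1)
  moreover have "\<mu> ((A - B) \<union> (D - B)) = \<mu> (A - B) + \<mu> (D - B) - \<mu> ((A - B) \<inter> (D - B))"
    using assms by (intro mean_Un) auto
  moreover have "\<mu> ((A - B) \<inter> (D - B)) \<le> \<mu> (A \<inter> D)" using assms by (intro mean_mono) auto
  moreover have "\<mu> (A \<inter> D) \<le> \<mu> A" using assms by (intro mean_mono) auto
  ultimately show ?thesis using assms(4) by linarith
qed

end

text \<open>A coset of \<open>H\<close> with representative \<open>r\<close> is covered by the two
  cosets of \<open>K\<close> through \<open>r\<close> and \<open>s \<otimes> r\<close>.\<close>

lemma (in group) card_cosets_index_two:
  assumes H: "subgroup H G" and K: "subgroup K G" and s: "s \<in> H"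
    and HK: "H \<subseteq> K \<union> (\<lambda>k. k \<otimes> s) ` K"
    and A: "A \<subseteq> carrier G" "finite ((\<lambda>x. H #> x) ` A)"
  shows "finite ((\<lambda>x. K #> x) ` A) \<and> card ((\<lambda>x. K #> x) ` A) \<le> 2 * card ((\<lambda>x. H #> x) ` A)"
proof -
  have Kc: "k \<in> carrier G" if "k \<in> K" for k using that subgroup.subset[OF K] by auto
  have sc: "s \<in> carrier G" using s subgroup.subset[OF H] by auto
  define r where "r C = (SOME x. x \<in> carrier G \<and> H #> x = C)" for C
  define U where "U = (\<Union>C\<in>(\<lambda>x. H #> x) ` A. {K #> r C, K #> (s \<otimes> r C)})"
  have sub: "(\<lambda>x. K #> x) ` A \<subseteq> U"
  proof (rule image_subsetI)
    fix x assume x: "x \<in> A"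
    then have xc: "x \<in> carrier G" using A by auto
    have "\<exists>y. y \<in> carrier G \<and> H #> y = H #> x" using xc by blast
    from someI_ex[OF this] have r: "r (H #> x) \<in> carrier G" "H #> r (H #> x) = H #> x" by (auto simp: r_def)
    have "x \<in> H #> r (H #> x)" using rcos_self[OF xc H] r by simp
    then obtain h where h: "h \<in> H" "x = h \<otimes> r (H #> x)" by (auto simp: r_coset_def)
    have absorb: "K #> (k \<otimes> y) = K #> y" if "k \<in> K" "y \<in> carrier G" for k y
    proof -
      have "K #> (k \<otimes> y) = (K #> k) #> y" using that Kc subgroup.subset[OF K] by (simp add: coset_mult_assoc)
      then show ?thesis using coset_join2[OF Kc[OF that(1)] K that(1)] by simp
    qed
    consider "h \<in> K" | k where "k \<in> K" "h = k \<otimes> s" using h(1) HK by auto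
    then have "K #> x = K #> r (H #> x) \<or> K #> x = K #> (s \<otimes> r (H #> x))"
    proof cases
      case 1
      then show ?thesis using absorb[OF 1 r(1)] h(2) by metis
    next
      case 2
      then have "x = k \<otimes> (s \<otimes> r (H #> x))" using h(2) Kc sc r(1) by (metis m_assoc)
      then show ?thesis using absorb[OF 2(1), of "s \<otimes> r (H #> x)"] sc r(1) by (metis m_closed)
    qed
    then show "K #> x \<in> U" unfolding U_def using x by blast
  qed
  have fin: "finite U" unfolding U_def using A(2) by (rule finite_UN_I) simp
  have "card U \<le> (\<Sum>C\<in>(\<lambda>x. H #> x) ` A. card {K #> r C, K #> (s \<otimes> r C)})"
    unfolding U_def by (rule card_UN_le[OF A(2)])
  also have "\<dots> \<le> (\<Sum>C\<in>(\<lambda>x. H #> x) ` A. 2)" by (rule sum_mono) (simp add: card_insert_if)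
  finally have "card U \<le> 2 * card ((\<lambda>x. H #> x) ` A)" by simp
  then show ?thesis using card_mono[OF fin sub] finite_subset[OF sub fin] by simp
qed

section \<open>Majority orientations and the breaking of ties\<close>

locale coloured_mean = coloured G S R H \<kappa> + mean_group G \<mu>
  for G (structure) and S R H and \<kappa> :: "'a \<Rightarrow> 'k" and \<mu>
begin

definition balanced :: "'a set \<Rightarrow> bool" where
  "balanced Y \<longleftrightarrow> (\<exists>P c. incident P c \<and> Y = hs P c) \<and> \<mu> Y = 1/2"

lemma balanced_sub: "balanced Y \<Longrightarrow> Y \<subseteq> carrier G" and balanced_mean: "balanced Y \<Longrightarrow> \<mu> Y = 1/2"
  using hs_sub by (auto simp: balanced_def)

text \<open>Each case of nestedness settles the mean of the intersection; when the two halves cover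
  the group, it is zero by inclusion and exclusion.\<close>

lemma balanced_Int:
  assumes "balanced Y" "balanced D" shows "\<mu> (Y \<inter> D) = 0 \<or> \<mu> (Y \<inter> D) = 1/2"
proof -
  note sub = assms[THEN balanced_sub] and half = assms[THEN balanced_mean]
  consider "Y \<inter> D = {}" | "Y \<subseteq> D" | "D \<subseteq> Y" | "Y \<union> D = carrier G"
    using assms hs_nested unfolding balanced_def by metis
  then show ?thesis
  proof cases
    case 4
    then show ?thesis using mean_Un[OF sub] half mean_one by simp
  qed (auto simp: mean_empty half Int_absorb1 Int_absorb2)
qed

lemma balanced_translate: "h \<in> H \<Longrightarrow> balanced Y \<Longrightarrow> balanced ((\<otimes>) h ` Y)"
  unfolding balanced_def using incident_translate hs_translate mean_inv H_carrier hs_sub by metis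

text \<open>Without ties a strict majority suffices: disjoint sets cannot both exceed one half, and
  of two sets covering the group one must reach it.\<close>

lemma ex_orientation_unbalanced:
  assumes "\<And>Y. \<not> balanced Y" "finite (rcosets H)"
  shows "oriented G S R H \<kappa> H (\<lambda>Y. \<mu> Y > 1/2)"
proof (rule oriented.intro[OF coloured_axioms], rule oriented_axioms.intro)
  show "subgroup H G" "H \<subseteq> H" "finite (rcosets H)" using H_sub assms by auto
  show "\<not> (\<mu> (hs P c) > 1/2 \<and> \<mu> (hs Q c) > 1/2)" if "incident P c" "incident Q c" "P \<noteq> Q" for P Q c
    using mean_add[OF hs_sub hs_sub hs_disjoint, OF that(1,2) that] mean_le_1[of "hs P c \<union> hs Q c"]
      hs_sub that by auto
  show "\<mu> (hs P c) > 1/2 \<or> \<mu> (hs P d) > 1/2" if inc: "incident P c" "incident P d" "c \<noteq> d" for P c d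
  proof -
    have "\<mu> (hs P c) \<noteq> 1/2" "\<mu> (hs P d) \<noteq> 1/2" using assms(1) inc unfolding balanced_def by blast+
    moreover have "1 \<le> \<mu> (hs P c) + \<mu> (hs P d)"
      using mean_Un_le[OF hs_sub[OF inc(1)] hs_sub[OF inc(2)]] hs_cover[OF inc] mean_one by simp
    ultimately show ?thesis by linarith
  qed
  show "(\<mu> ((\<otimes>) k ` hs P c) > 1/2) = (\<mu> (hs P c) > 1/2)" if "k \<in> H" "incident P c" for k P c
    using that H_carrier hs_sub by (simp add: mean_inv)
qed

text \<open>A balanced half-space \<open>D\<close> breaks ties: up to null sets every balanced
  half-space is \<open>D\<close> or its complement, and the former count as big. An element of
  \<open>H\<close> either preserves \<open>D\<close> up to null sets or exchanges it with its
  complement; \<open>K\<close> consists of the preserving ones.\<close>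

lemma ex_orientation_balanced:
  assumes D: "balanced D" and finH: "finite (rcosets H)"
  shows "\<exists>K s. s \<in> H \<and> H \<subseteq> K \<union> (\<lambda>k. k \<otimes> s) ` K \<and>
    oriented G S R H \<kappa> K (\<lambda>Y. \<mu> Y > 1/2 \<or> \<mu> Y = 1/2 \<and> \<mu> (Y \<inter> D) = 1/2)"
proof -
  note Dc = balanced_sub[OF D] and Dh = balanced_mean[OF D]
  define K where "K = {h \<in> H. \<mu> ((\<otimes>) h ` D \<inter> D) = 1/2}"
  have hD: "(\<otimes>) h ` D \<subseteq> carrier G" "\<mu> ((\<otimes>) h ` D) = 1/2" if "h \<in> H" for h
    using balanced_translate[OF that D] balanced_sub balanced_mean by auto
  have K_or: "\<mu> ((\<otimes>) h ` D \<inter> D) = 0" if "h \<in> H" "h \<notin> K" for h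
    using balanced_Int[OF balanced_translate[OF that(1) D] D] that by (auto simp: K_def)
  have shift: "\<mu> ((\<otimes>) (h \<otimes> k) ` D \<inter> (\<otimes>) h ` D) = \<mu> ((\<otimes>) k ` D \<inter> D)" if "h \<in> H" "k \<in> H" for h k
    using that hD H_carrier Dc by (simp add: translate_mult mean_image_Int)
  have mult_H: "h \<otimes> k \<in> H" if "h \<in> H" "k \<in> H" for h k using that subgroup.m_closed[OF H_sub] by blast
  have K_inv: "inv h \<in> K" if "h \<in> K" for h
  proof -
    have h: "h \<in> H" "inv h \<in> H" using that H_inv by (auto simp: K_def)
    have "\<mu> ((\<otimes>) (h \<otimes> inv h) ` D \<inter> (\<otimes>) h ` D) = \<mu> ((\<otimes>) (inv h) ` D \<inter> D)" using shift h by blast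
    then show ?thesis using h that H_carrier[OF h(1)] Dc by (simp add: K_def translate_one Int_commute)
  qed
  have sK: "subgroup K G"
  proof (rule subgroupI)
    show "K \<subseteq> carrier G" using H_carrier by (auto simp: K_def)
    show "K \<noteq> {}" using subgroup.one_closed[OF H_sub] Dh Dc by (auto simp: K_def translate_one intro!: exI[of _ \<one>])
    show "inv h \<in> K" if "h \<in> K" for h using K_inv[OF that] .
    fix h k assume hk: "h \<in> K" "k \<in> K"
    then have H: "h \<in> H" "k \<in> H" "h \<otimes> k \<in> H" using mult_H by (auto simp: K_def)
    have "\<mu> ((\<otimes>) (h \<otimes> k) ` D \<inter> D) = 1/2"
      using half_trans[OF hD(1)[OF H(3)] hD(1)[OF H(1)] Dc hD(2)[OF H(3)] hD(2)[OF H(1)]] shift[OF H(1,2)] hk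
      by (simp add: K_def)
    then show "h \<otimes> k \<in> K" using H by (simp add: K_def)
  qed
  have "\<exists>s\<in>H. H \<subseteq> K \<union> (\<lambda>k. k \<otimes> s) ` K"
  proof (cases "H \<subseteq> K")
    case True
    then show ?thesis using subgroup.one_closed[OF H_sub] by blast
  next
    case False
    then obtain s where s: "s \<in> H" "s \<notin> K" by blast
    then have is': "inv s \<in> H" "inv s \<notin> K" using H_inv K_inv[of "inv s"] H_carrier by auto
    \<comment> \<open>Both \<open>h\<close> and \<open>inv s\<close> exchange the two halves, so
      their product preserves them.\<close>
    have "h \<in> (\<lambda>k. k \<otimes> s) ` K" if h: "h \<in> H" "h \<notin> K" for h
    proof -
      have his: "h \<otimes> inv s \<in> H" using mult_H h is' by blast
      have "\<mu> ((\<otimes>) (h \<otimes> inv s) ` D \<inter> D) = 1/2"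
        using half_complement[OF hD(1)[OF his] hD(1)[OF h(1)] Dc hD(2)[OF his] hD(2)[OF h(1)] Dh]
          shift[OF h(1) is'(1)] K_or[OF is'] K_or[OF h] by simp
      then have "h \<otimes> inv s \<in> K" using his by (simp add: K_def)
      moreover have "h = h \<otimes> inv s \<otimes> s" using H_carrier h(1) s(1) by (simp add: m_assoc)
      ultimately show ?thesis by blast
    qed
    then show ?thesis using s(1) by blast
  qed
  then obtain s where s: "s \<in> H" "H \<subseteq> K \<union> (\<lambda>k. k \<otimes> s) ` K" by blast
  have rcH: "rcosets H = (\<lambda>x. H #> x) ` carrier G" "rcosets K = (\<lambda>x. K #> x) ` carrier G"
    by (auto simp: RCOSETS_def)
  have finK: "finite (rcosets K)"
    using card_cosets_index_two[OF H_sub sK s subset_refl] finH unfolding rcH by blast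
  have hs_cases: "\<mu> Y = 1/2 \<Longrightarrow> \<mu> (Y \<inter> D) = 0 \<or> \<mu> (Y \<inter> D) = 1/2" if "incident P c" "Y = hs P c" for Y P c
    using balanced_Int[OF _ D, of Y] that unfolding balanced_def by blast
  have "oriented G S R H \<kappa> K (\<lambda>Y. \<mu> Y > 1/2 \<or> \<mu> Y = 1/2 \<and> \<mu> (Y \<inter> D) = 1/2)"
  proof (rule oriented.intro[OF coloured_axioms], rule oriented_axioms.intro)
    show "subgroup K G" "K \<subseteq> H" "finite (rcosets K)" using sK finK by (auto simp: K_def)
  next
    fix P Q c assume inc: "incident P c" "incident Q c" "P \<noteq> Q"
    note sub = hs_sub[OF inc(1)] hs_sub[OF inc(2)] and disj = hs_disjoint[OF inc]
    have 1: "\<mu> (hs P c) + \<mu> (hs Q c) \<le> 1"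
      using mean_add[OF sub disj] mean_le_1[of "hs P c \<union> hs Q c"] sub by auto
    have "\<mu> (hs P c \<inter> D \<union> hs Q c \<inter> D) = \<mu> (hs P c \<inter> D) + \<mu> (hs Q c \<inter> D)"
      using sub disj by (intro mean_add) auto
    moreover have "\<mu> (hs P c \<inter> D \<union> hs Q c \<inter> D) \<le> \<mu> D" using Dc by (intro mean_mono) auto
    \<comment> \<open>A strict majority leaves less than one half for a disjoint set, and two ties
      would each claim one half from \<open>D\<close>, which has only one half in all.\<close>
    ultimately show "\<not> ((\<mu> (hs P c) > 1/2 \<or> \<mu> (hs P c) = 1/2 \<and> \<mu> (hs P c \<inter> D) = 1/2) \<and>
      (\<mu> (hs Q c) > 1/2 \<or> \<mu> (hs Q c) = 1/2 \<and> \<mu> (hs Q c \<inter> D) = 1/2))"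
      using 1 Dh by linarith
  next
    fix P c d assume inc: "incident P c" "incident P d" "c \<noteq> d"
    note sub = hs_sub[OF inc(1)] hs_sub[OF inc(2)] and cov = hs_cover[OF inc]
    have 1: "1 \<le> \<mu> (hs P c) + \<mu> (hs P d)"
      using mean_Un_le[OF sub] cov mean_one by simp
    have "hs P c \<inter> D \<union> hs P d \<inter> D = D" using cov Dc by blast
    moreover have "\<mu> (hs P c \<inter> D \<union> hs P d \<inter> D) \<le> \<mu> (hs P c \<inter> D) + \<mu> (hs P d \<inter> D)"
      by (rule mean_Un_le) (use sub in auto)
    ultimately have 2: "\<mu> D \<le> \<mu> (hs P c \<inter> D) + \<mu> (hs P d \<inter> D)" by simp
    \<comment> \<open>If neither side has a majority, both are ties; together they cover
      \<open>D\<close>, so one meets it in positive mean, which must be one half.\<close>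
    show "(\<mu> (hs P c) > 1/2 \<or> \<mu> (hs P c) = 1/2 \<and> \<mu> (hs P c \<inter> D) = 1/2) \<or>
      (\<mu> (hs P d) > 1/2 \<or> \<mu> (hs P d) = 1/2 \<and> \<mu> (hs P d \<inter> D) = 1/2)"
      using hs_cases[OF inc(1) HOL.refl] hs_cases[OF inc(2) HOL.refl] 1 2 Dh by linarith
  next
    fix k P c assume k: "k \<in> K" and inc: "incident P c"
    have kH: "k \<in> H" "k \<in> carrier G" and kD: "\<mu> ((\<otimes>) k ` D \<inter> D) = 1/2" using k H_carrier by (auto simp: K_def)
    define Y where "Y = hs P c"
    have Y: "Y \<subseteq> carrier G" using hs_sub inc by (simp add: Y_def)
    have kY: "(\<otimes>) k ` Y \<subseteq> carrier G" "\<mu> ((\<otimes>) k ` Y) = \<mu> Y" using Y kH by (auto simp: mean_inv)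
    have eq: "\<mu> ((\<otimes>) k ` Y \<inter> (\<otimes>) k ` D) = \<mu> (Y \<inter> D)" using kH Y Dc by (simp add: mean_image_Int)
    have "\<mu> ((\<otimes>) k ` Y \<inter> D) = 1/2 \<longleftrightarrow> \<mu> (Y \<inter> D) = 1/2" if half: "\<mu> Y = 1/2"
    proof
      assume "\<mu> ((\<otimes>) k ` Y \<inter> D) = 1/2"
      then show "\<mu> (Y \<inter> D) = 1/2"
        using half_trans[OF kY(1) Dc hD(1)[OF kH(1)] _ Dh] half kY kD eq by (simp add: Int_commute)
    next
      assume "\<mu> (Y \<inter> D) = 1/2"
      then show "\<mu> ((\<otimes>) k ` Y \<inter> D) = 1/2"
        using half_trans[OF kY(1) hD(1)[OF kH(1)] Dc _ hD(2)[OF kH(1)]] half kY kD eq by simp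
    qed
    then show "(\<mu> ((\<otimes>) k ` hs P c) > 1/2 \<or> \<mu> ((\<otimes>) k ` hs P c) = 1/2 \<and> \<mu> ((\<otimes>) k ` hs P c \<inter> D) = 1/2) =
      (\<mu> (hs P c) > 1/2 \<or> \<mu> (hs P c) = 1/2 \<and> \<mu> (hs P c \<inter> D) = 1/2)"
      using kY(2) unfolding Y_def by auto
  qed
  then show ?thesis using s by blast
qed

text \<open>Passing to \<open>K\<close> at most doubles the number of cosets met; the summand 2
  consists of the flow element of \<open>K\<close> and the element \<open>s\<close> that leads from
  \<open>K\<close> back to \<open>H\<close>.\<close>

lemma subgroup_few_generators:
  assumes finH: "finite (rcosets H)"
    and comps: "\<And>g. g \<in> carrier G \<Longrightarrow> card ((\<lambda>x. H #> x) ` comp g) \<le> M"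
    and walls: "card ((\<lambda>x. H #> x) ` bd) \<le> M"
  shows "\<exists>A. finite A \<and> A \<subseteq> H \<and> card A \<le> 2 * M * card B + 2 \<and> generate G A = H"
proof -
  have "\<exists>K s big. s \<in> H \<and> H \<subseteq> K \<union> (\<lambda>k. k \<otimes> s) ` K \<and> oriented G S R H \<kappa> K big"
  proof (cases "\<exists>D. balanced D")
    case True
    then show ?thesis using ex_orientation_balanced finH by blast
  next
    case False
    then show ?thesis using ex_orientation_unbalanced finH subgroup.one_closed[OF H_sub] by blast
  qed
  then obtain K s big where s: "s \<in> H" "H \<subseteq> K \<union> (\<lambda>k. k \<otimes> s) ` K" and or: "oriented G S R H \<kappa> K big"
    by blast
  interpret oriented G S R H \<kappa> K big by (rule or)
  have finI: "finite ((\<lambda>x. H #> x) ` A)" if "A \<subseteq> carrier G" for A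
    using that by (intro finite_subset[OF _ finH]) (auto simp: RCOSETS_def)
  have count: "card ((\<lambda>x. K #> x) ` A) \<le> 2 * M" if "A \<subseteq> carrier G" "card ((\<lambda>x. H #> x) ` A) \<le> M" for A
    using card_cosets_index_two[OF H_sub K_sub s that(1) finI[OF that(1)]] that(2) by linarith
  have "card ((\<lambda>x. K #> x) ` comp g) \<le> 2 * M" if "g \<in> carrier G" for g
    using count comp_sub comps that by blast
  moreover have "card ((\<lambda>x. K #> x) ` bd) \<le> 2 * M" using count walls bd_carrier by blast
  ultimately obtain A where A: "finite A" "A \<subseteq> K" "card A \<le> Suc (2 * M * card B)" "generate G A = K"
    using few_generators[of "2 * M"] by blast
  have AH: "insert s A \<subseteq> H" using A K_H s by auto
  have Ac: "insert s A \<subseteq> carrier G" using AH H_carrier by blast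
  have "H \<subseteq> generate G (insert s A)"
  proof
    fix h assume "h \<in> H"
    have KA: "K \<subseteq> generate G (insert s A)" using mono_generate[of A "insert s A"] A(4) by blast
    have sA: "s \<in> generate G (insert s A)" by (intro generate.incl) simp
    from \<open>h \<in> H\<close> s(2) consider "h \<in> K" | k where "k \<in> K" "h = k \<otimes> s" by blast
    then show "h \<in> generate G (insert s A)"
      by cases (use KA sA in \<open>auto intro: generate.eng\<close>)
  qed
  then have "generate G (insert s A) = H" using generate_subgroup_incl[OF AH H_sub] by blast
  then show ?thesis using A AH by (intro exI[of _ "insert s A"]) (auto simp: card_insert_if)
qed

end

section \<open>The rank gradient\<close>

lemma (in group) card_rcosets_less:
  assumes H: "subgroup H G" and K: "subgroup K G" and KH: "K \<subset> H" and fin: "finite (rcosets K)"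
  shows "card (rcosets H) < card (rcosets K)"
proof -
  define f where "f C = H #> (SOME x. x \<in> C)" for C
  have f: "f (K #> x) = H #> x" if x: "x \<in> carrier G" for x
  proof -
    have "(SOME y. y \<in> K #> x) \<in> K #> x" using rcos_self[OF x K] by (rule someI)
    then have "(SOME y. y \<in> K #> x) \<in> H #> x" using KH by (auto simp: r_coset_def)
    from repr_independence[OF this x H] show ?thesis by (simp add: f_def)
  qed
  have img: "f ` (rcosets K) = rcosets H" using f by (auto simp: RCOSETS_def image_iff)
  obtain h where h: "h \<in> H" "h \<notin> K" using KH by blast
  have hc: "h \<in> carrier G" using h subgroup.subset[OF H] by auto
  have "f (K #> h) = f (K #> \<one>)"
    using f[OF hc] f[OF one_closed] coset_join2[OF hc H h(1)] coset_join2[OF one_closed H subgroup.one_closed[OF H]] by simp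
  moreover have "K #> h \<noteq> K #> \<one>"
  proof
    assume "K #> h = K #> \<one>"
    then have "h \<in> K #> \<one>" using rcos_self[OF hc K] by simp
    then show False using h(2) coset_join2[OF one_closed K subgroup.one_closed[OF K]] by simp
  qed
  moreover have "K #> h \<in> rcosets K" "K #> \<one> \<in> rcosets K" using hc by (auto simp: RCOSETS_def)
  ultimately have "\<not> inj_on f (rcosets K)" unfolding inj_on_def by metis
  then have "card (f ` (rcosets K)) \<noteq> card (rcosets K)" using eq_card_imp_inj_on[OF fin] by blast
  then show ?thesis using card_image_le[OF fin, of f] img by simp
qed

lemma (in group) min_gens_subgroup_le:
  assumes "subgroup H G" "finite A" "A \<subseteq> H" "generate G A = H"
  shows "min_gens (G\<lparr>carrier := H\<rparr>) \<le> card A"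
proof -
  have "generate (G\<lparr>carrier := H\<rparr>) A = H" using generate_consistent[OF assms(3,1)] assms(4) by simp
  then show ?thesis unfolding min_gens_def using assms by (intro Least_le exI[of _ A]) simp
qed

text \<open>Each strict inclusion raises the index by at least one; finiteness matters because
  \<open>card\<close> is zero on infinite sets.\<close>

lemma (in group) chain_index:
  assumes "is_chain G \<Gamma>" shows "n < group_index G (\<Gamma> n)"
proof (induction n)
  case 0
  have "\<Gamma> 0 #> \<one> \<in> rcosets (\<Gamma> 0)" by (auto simp: RCOSETS_def)
  moreover have "finite (rcosets (\<Gamma> 0))" using assms unfolding is_chain_def by blast
  ultimately show ?case unfolding group_index_def by (auto simp: card_gt_0_iff)
next
  case (Suc n)
  have "group_index G (\<Gamma> n) < group_index G (\<Gamma> (Suc n))"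
    using assms unfolding is_chain_def group_index_def by (intro card_rcosets_less) auto
  then show ?case using Suc by simp
qed

locale presented_mean = presented G S R + mean_group G \<mu> for G (structure) and S R \<mu>
begin

lemma countable_carrier: "countable (carrier G)"
proof -
  have "countable (lists (S \<times> (UNIV :: bool set)))" using fin_S by (intro countable_lists countable_finite) auto
  moreover have "carrier G \<subseteq> ev ` lists (S \<times> UNIV)" using word_exists by (force simp: lists_eq_set)
  ultimately show ?thesis by (meson countable_image countable_subset)
qed

text \<open>A component lies in one colour class and meets at most \<open>M\<close> cosets; the
  boundary meets at most \<open>W\<close>, a proportion \<open>\<epsilon>\<close> of the index.
  Their sum bounds both types of tree vertex.\<close>

lemma min_gens_bound:
  assumes inf: "infinite (carrier G)" and \<epsilon>: "\<epsilon> > 0"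
  shows "\<exists>M. \<forall>H. subgroup H G \<and> finite (rcosets H) \<longrightarrow>
    real (min_gens (G\<lparr>carrier := H\<rparr>)) \<le> 2 * (real M + \<epsilon> * real (group_index G H)) * real (card B) + 2"
proof -
  obtain M where M: "\<And>H. subgroup H G \<and> finite (rcosets H) \<Longrightarrow>
    (\<exists>\<kappa> :: 'a set \<Rightarrow> 'a set set. (\<forall>u\<in>rcosets H. card {v\<in>rcosets H. \<kappa> v = \<kappa> u} \<le> M) \<and>
      real (card {u\<in>rcosets H. \<exists>t\<in>T. \<kappa> (u #> t) \<noteq> \<kappa> u}) \<le> \<epsilon> * real (card (rcosets H)))"
    using coset_partition[OF countable_carrier inf fin_T _ \<epsilon>] T_sub by blast
  show ?thesis
  proof (intro exI[of _ M] allI impI)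
    fix H assume H: "subgroup H G \<and> finite (rcosets H)"
    then have sH: "subgroup H G" and fH: "finite (rcosets H)" by auto
    obtain \<kappa> :: "'a set \<Rightarrow> 'a set set" where \<kappa>: "\<And>u. u \<in> rcosets H \<Longrightarrow> card {v\<in>rcosets H. \<kappa> v = \<kappa> u} \<le> M"
      "real (card {u\<in>rcosets H. \<exists>t\<in>T. \<kappa> (u #> t) \<noteq> \<kappa> u}) \<le> \<epsilon> * real (card (rcosets H))"
      using M[OF H] by blast
    have Hc: "h \<in> carrier G" if "h \<in> H" for h using that subgroup.subset[OF sH] by auto
    have rc: "H #> g \<in> rcosets H" if "g \<in> carrier G" for g using that by (auto simp: RCOSETS_def)
    have \<kappa>_inv: "\<kappa> (H #> (h \<otimes> g)) = \<kappa> (H #> g)" if hg: "h \<in> H" "g \<in> carrier G" for h g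
    proof -
      have "H #> (h \<otimes> g) = (H #> h) #> g" using hg Hc subgroup.subset[OF sH] by (simp add: coset_mult_assoc)
      then show ?thesis using coset_join2[OF Hc[OF hg(1)] sH hg(1)] by simp
    qed
    interpret coloured_mean G S R H "\<lambda>g. \<kappa> (H #> g)" \<mu>
      by (intro coloured_mean.intro coloured.intro coloured_axioms.intro presented_axioms mean_group_axioms sH \<kappa>_inv)
    define W where "W = card {u\<in>rcosets H. \<exists>t\<in>T. \<kappa> (u #> t) \<noteq> \<kappa> u}"
    have "card ((\<lambda>x. H #> x) ` comp g) \<le> M + W" if g: "g \<in> carrier G" for g
    proof -
      have "(\<lambda>x. H #> x) ` comp g \<subseteq> {v\<in>rcosets H. \<kappa> v = \<kappa> (H #> g)}"
        using comp_sub[OF g] rc comp_colour by blast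
      then have "card ((\<lambda>x. H #> x) ` comp g) \<le> card {v\<in>rcosets H. \<kappa> v = \<kappa> (H #> g)}"
        using fH by (intro card_mono) auto
      then show ?thesis using \<kappa>(1)[OF rc[OF g]] by linarith
    qed
    moreover have "card ((\<lambda>x. H #> x) ` bd) \<le> M + W"
    proof -
      have "H #> g \<in> {u\<in>rcosets H. \<exists>t\<in>T. \<kappa> (u #> t) \<noteq> \<kappa> u}" if g: "g \<in> bd" for g
      proof -
        obtain t where t: "t \<in> T" "\<kappa> (H #> (g \<otimes> t)) \<noteq> \<kappa> (H #> g)" using g by (auto simp: bd_def)
        moreover have "H #> (g \<otimes> t) = (H #> g) #> t"
          using bd_carrier[OF g] T_sub[OF t(1)] subgroup.subset[OF sH] by (simp add: coset_mult_assoc)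
        ultimately show ?thesis using rc[OF bd_carrier[OF g]] by auto
      qed
      then have "card ((\<lambda>x. H #> x) ` bd) \<le> W" unfolding W_def using fH by (intro card_mono) auto
      then show ?thesis by simp
    qed
    ultimately obtain A where A: "finite A" "A \<subseteq> H" "card A \<le> 2 * (M + W) * card B + 2" "generate G A = H"
      using subgroup_few_generators[OF fH] by blast
    have "real (min_gens (G\<lparr>carrier := H\<rparr>)) \<le> real (card A)"
      using min_gens_subgroup_le[OF sH A(1,2,4)] by simp
    also have "\<dots> \<le> real (2 * (M + W) * card B + 2)" using A(3) by (simp only: of_nat_le_iff)
    also have "\<dots> = 2 * (real M + real W) * real (card B) + 2" by simp
    also have "\<dots> \<le> 2 * (real M + \<epsilon> * real (group_index G H)) * real (card B) + 2"
      using \<kappa>(2) unfolding W_def group_index_def by (intro add_right_mono mult_right_mono) auto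
    finally show "real (min_gens (G\<lparr>carrier := H\<rparr>))
      \<le> 2 * (real M + \<epsilon> * real (group_index G H)) * real (card B) + 2" .
  qed
qed

lemma chain_rank_gradient:
  assumes inf: "infinite (carrier G)" and \<Gamma>: "is_chain G \<Gamma>"
  shows "(\<lambda>n. rg_ratio G (\<Gamma> n)) \<longlonglongrightarrow> 0"
proof (rule LIMSEQ_I)
  fix e :: real assume e: "e > 0"
  define b where "b = real (card B)"
  \<comment> \<open>Chosen so that \<open>2 * b * \<epsilon>\<close> is at most
    \<open>e / 2\<close>; the summand 1 avoids division by zero.\<close>
  define \<epsilon> where "\<epsilon> = e / (4 * b + 1)"
  have b: "b \<ge> 0" by (simp add: b_def)
  have \<epsilon>: "\<epsilon> > 0" using e b by (simp add: \<epsilon>_def add_nonneg_pos)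
  obtain M where M: "\<And>H. subgroup H G \<and> finite (rcosets H) \<Longrightarrow>
    real (min_gens (G\<lparr>carrier := H\<rparr>)) \<le> 2 * (real M + \<epsilon> * real (group_index G H)) * b + 2"
    using min_gens_bound[OF inf \<epsilon>] unfolding b_def by blast
  \<comment> \<open>The part that does not grow with the index; its 1 is the 2 of the generator
    bound less the 1 in the definition of the ratio.\<close>
  define C where "C = 2 * real M * b + 1"
  have C: "C \<ge> 1" using b by (simp add: C_def)
  obtain n0 :: nat where n0: "2 * C / e < real n0" using reals_Archimedean2 by blast
  show "\<exists>no. \<forall>n\<ge>no. norm (rg_ratio G (\<Gamma> n) - 0) < e"
  proof (intro exI[of _ n0] allI impI)
    fix n assume n: "n0 \<le> n"
    define i where "i = real (group_index G (\<Gamma> n))"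
    define m where "m = real (min_gens (G\<lparr>carrier := \<Gamma> n\<rparr>))"
    have i: "real n < i" using chain_index[OF \<Gamma>, of n] by (simp add: i_def)
    then have Ci: "C < e / 2 * i" using n0 n e by (simp add: field_simps) (smt (verit) mult_left_mono of_nat_mono)
    have "m \<le> 2 * (real M + \<epsilon> * i) * b + 2"
      unfolding m_def i_def using \<Gamma> by (intro M) (auto simp: is_chain_def)
    then have "m - 1 \<le> C + 2 * b * \<epsilon> * i" by (simp add: C_def algebra_simps)
    also have "2 * b * \<epsilon> \<le> e / 2" using e b by (simp add: \<epsilon>_def field_simps)
    then have "C + 2 * b * \<epsilon> * i \<le> C + e / 2 * i" using i by (intro add_left_mono mult_right_mono) auto
    finally have up: "m - 1 < e * i" using Ci by simp
    \<comment> \<open>\<open>min_gens\<close> may be zero, in which case the numerator is -1; this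
      gives the lower estimate.\<close>
    have "e * i > 1" using Ci C by simp
    then have "- (e * i) < m - 1" by (simp add: m_def)
    with up have "\<bar>m - 1\<bar> < e * i" by (simp add: abs_less_iff)
    then have "\<bar>(m - 1) / i\<bar> < e" using i by (simp add: field_simps)
    then show "norm (rg_ratio G (\<Gamma> n) - 0) < e" by (simp add: rg_ratio_def m_def i_def)
  qed
qed

end

theorem theorem1:
  fixes G :: "('a, 'b) monoid_scheme" and \<Gamma> :: "nat \<Rightarrow> 'a set"
  assumes "group G" and "finitely_presented G" and "infinite (carrier G)" and "amenable G"
    and "is_chain G \<Gamma>"
  shows "(\<lambda>n. rg_ratio G (\<Gamma> n)) \<longlonglongrightarrow> 0"
proof -
  obtain S R where SR: "finite S" "S \<subseteq> carrier G" "generate G S = carrier G" "finite R"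
    "\<forall>r\<in>R. set r \<subseteq> S \<times> UNIV"
    "\<forall>w. set w \<subseteq> S \<times> UNIV \<longrightarrow> (word_eval G w = \<one>\<^bsub>G\<^esub> \<longleftrightarrow> pres_eq R w [])"
    using assms(2) unfolding finitely_presented_def by blast
  obtain \<mu> :: "'a set \<Rightarrow> real" where "\<mu> (carrier G) = 1 \<and> (\<forall>A \<subseteq> carrier G. \<mu> A \<ge> 0) \<and>
    (\<forall>A B. A \<subseteq> carrier G \<longrightarrow> B \<subseteq> carrier G \<longrightarrow> A \<inter> B = {} \<longrightarrow> \<mu> (A \<union> B) = \<mu> A + \<mu> B) \<and>
    (\<forall>g\<in>carrier G. \<forall>A \<subseteq> carrier G. \<mu> (g <#\<^bsub>G\<^esub> A) = \<mu> A)"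
    using assms(4) unfolding amenable_def by (elim exE)
  then have \<mu>: "\<mu> (carrier G) = 1" "\<And>A. A \<subseteq> carrier G \<Longrightarrow> 0 \<le> \<mu> A"
    "\<And>A B. A \<subseteq> carrier G \<Longrightarrow> B \<subseteq> carrier G \<Longrightarrow> A \<inter> B = {} \<Longrightarrow> \<mu> (A \<union> B) = \<mu> A + \<mu> B"
    "\<And>g A. g \<in> carrier G \<Longrightarrow> A \<subseteq> carrier G \<Longrightarrow> \<mu> (g <#\<^bsub>G\<^esub> A) = \<mu> A" by simp_all
  have "g <#\<^bsub>G\<^esub> A = (\<otimes>\<^bsub>G\<^esub>) g ` A" for g A by (auto simp: l_coset_def)
  then have "mean_group G \<mu>"
    using \<mu> by (intro mean_group.intro mean_group_axioms.intro assms(1)) simp_all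
  moreover have "presented G S R"
    by (intro presented.intro presented_axioms.intro assms(1)) (use SR in blast)+
  ultimately interpret presented_mean G S R \<mu> by (rule presented_mean.intro[rotated])
  show ?thesis using assms(3,5) by (rule chain_rank_gradient)
qed

end
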